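(* Let $J,D,G,P,\Pi\in M_m(\mathbb R)$ with $J=J^T>0$, $D=D^T$, $\Pi=\Pi^T$, $G=-G^T$, $P=-P^T$, and put $$A=J^{-1/2}(D+G)J^{-1/2},\qquad B=J^{-1/2}(P+\Pi)J^{-1/2}.$$ Suppose that matrices $V,C\in M_m(\mathbb R)$ with $\det C\ne0$ and $V+V^T>0$ satisfy the conditions $$CV_R=A_RC,$$ $$\left\{(4B-A^2)A^{(n)}(CVC^{-1}-A)\right\}=0,\qquad n=0,1,\ldots,m^2-1,$$ $$V^2-(V^2)^T+C^{-1}(4B-A^2)C-C^T(4B-A^2)^T(C^{-1})^T=0.$$ Consider the symmetric matrix $$W=\frac14V^2+C^{-1}\left(B-\frac14A^2\right)C.$$ If $W$ is positive definite, then the null solution of the system $$J\ddot{\mathbf x}+(D+G)\dot{\mathbf x}+(P+\Pi)\mathbf x=0$$ is asymptotically stable in the sense of Lyapunov. If $W$ is nonsingular and has at least one negative eigenvalue, then the null solution of this system is unstable in the sense of Lyapunov.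
   Context: $M_m(\mathbb R)$ is the space of real $m\times m$ matrices; $X>0$ for a symmetric matrix means positive definite; $J^{-1/2}$ is the inverse of the symmetric positive definite square root of $J$. Iterated commutators: $[X,Y]=XY-YX$; $\{A_1\}=A_1$, $\{A_1A_2\}=[A_1,A_2]$ and $\{A_1A_2\ldots A_n\}=[\{A_1\ldots A_{n-1}\},A_n]$. The symbol $A^{(n)}$ inside braces means that $A$ is repeated $n$ times; thus $\{ZA^{(0)}\}=Z$, $\{ZA^{(n)}\}=[\{ZA^{(n-1)}\},A]$, and $\{ZA^{(n)}X\}=[\{ZA^{(n)}\},X]$. Real part $A_R$: for $A\in M_m(\mathbb R)$ write the Jordan form $A=T\,\mathrm{diag}[\lambda_1E^{(p_1)}+H^{(p_1)},\ldots,\lambda_rE^{(p_r)}+H^{(p_r)}]\,T^{-1}$ with $T$ a nonsingular complex matrix, $\lambda_k=\alpha_k+i\beta_k$ ($\alpha_k,\beta_k\in\mathbb R$), $E^{(p)}$ the $p\times p$ identity, and $H^{(p)}$ the $p\times p$ matrix with ones on the first superdiagonal and zeros elsewhere. Then $A_R=T\,\mathrm{diag}[\alpha_1E^{(p_1)}+H^{(p_1)},\ldots,\alpha_rE^{(p_r)}+H^{(p_r)}]\,T^{-1}$, which is a real matrix. $V_R$ is defined in the same way from $V$. Stability of the null solution refers to the equivalent first-order system in $(\mathbf x,\dot{\mathbf x})$. *)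

theory Defs
  imports "Jordan_Normal_Form.Jordan_Normal_Form" "HOL-Analysis.Analysis"
begin

no_notation vec_index (infixl "$" 100)
hide_const (open) Matrix.mat Matrix.row Matrix.col Matrix.vec Determinant.det

definition pos_def :: "real^'m^'m \<Rightarrow> bool" where
  "pos_def X \<longleftrightarrow> transpose X = X \<and> (\<forall>x. x \<noteq> 0 \<longrightarrow> x \<bullet> (X *v x) > 0)"

definition pos_def_sqrt :: "real^'m^'m \<Rightarrow> real^'m^'m" where
  "pos_def_sqrt J = (THE S. pos_def S \<and> S ** S = J)"

definition inv_sqrt :: "real^'m^'m \<Rightarrow> real^'m^'m" where
  "inv_sqrt J = matrix_inv (pos_def_sqrt J)"

definition commutator :: "real^'m^'m \<Rightarrow> real^'m^'m \<Rightarrow> real^'m^'m" where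
  "commutator X Y = X ** Y - Y ** X"

text \<open>Left-nested commutators: \<open>iter_commutator Z [A1, ..., An] = [...[[Z, A1], A2]..., An]\<close>.\<close>

definition iter_commutator :: "real^'m^'m \<Rightarrow> (real^'m^'m) list \<Rightarrow> real^'m^'m" where
  "iter_commutator Z As = foldl commutator Z As"

text \<open>
  Real matrices are viewed as complex matrices of the kind used by the Jordan normal form
  library, via a fixed enumeration of the index type. The real part defined below commutes with
  permutation similarities, so it does not depend on the enumeration.
\<close>

definition complex_mat :: "real^'m^'m \<Rightarrow> complex Matrix.mat" where
  "complex_mat A =
     Matrix.mat CARD('m) CARD('m)
       (\<lambda>(i, j). complex_of_real (A $ from_nat_into UNIV i $ from_nat_into UNIV j))"

text \<open>
  \<open>R\<close> arises from a Jordan form of \<open>A\<close> by replacing each eigenvalue by its real part while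
  keeping the transforming matrix \<open>T\<close> and the superdiagonal ones; \<open>T'\<close> is the inverse of \<open>T\<close>.
  Such an \<open>R\<close> exists, is real, and does not depend on the choice of the Jordan form.
\<close>

definition is_real_part :: "real^'m^'m \<Rightarrow> real^'m^'m \<Rightarrow> bool" where
  "is_real_part A R \<longleftrightarrow>
     (\<exists>T T' blocks. 0 \<notin> fst ` set blocks
        \<and> similar_mat_wit (complex_mat A) (jordan_matrix blocks) T T'
        \<and> similar_mat_wit (complex_mat R)
            (jordan_matrix (map (\<lambda>(p, z). (p, complex_of_real (Re z))) blocks)) T T')"

definition real_part :: "real^'m^'m \<Rightarrow> real^'m^'m" where
  "real_part A = (THE R. is_real_part A R)"

text \<open>
  Solutions of \<open>J x'' + K x' + L x = 0\<close> on \<open>[0, \<infinity>)\<close>, written as pairs \<open>z = (x, x')\<close>.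
  For invertible \<open>J\<close> the system is linear with constant coefficients, so every solution extends
  to \<open>[0, \<infinity>)\<close> and the initial time may be taken to be \<open>0\<close>.
\<close>

definition second_order_solution ::
    "real^'m^'m \<Rightarrow> real^'m^'m \<Rightarrow> real^'m^'m \<Rightarrow> (real \<Rightarrow> (real^'m) \<times> (real^'m)) \<Rightarrow> bool" where
  "second_order_solution J K L z \<longleftrightarrow>
     (\<forall>t\<ge>0. ((\<lambda>s. fst (z s)) has_vector_derivative snd (z t)) (at t within {0..}) \<and>
       (\<exists>a. ((\<lambda>s. snd (z s)) has_vector_derivative a) (at t within {0..}) \<and>
            J *v a + K *v snd (z t) + L *v fst (z t) = 0))"

definition null_stable :: "real^'m^'m \<Rightarrow> real^'m^'m \<Rightarrow> real^'m^'m \<Rightarrow> bool" where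
  "null_stable J K L \<longleftrightarrow>
     (\<forall>\<epsilon>>0. \<exists>\<delta>>0. \<forall>z. second_order_solution J K L z \<and> norm (z 0) < \<delta> \<longrightarrow>
        (\<forall>t\<ge>0. norm (z t) < \<epsilon>))"

definition null_asymptotically_stable :: "real^'m^'m \<Rightarrow> real^'m^'m \<Rightarrow> real^'m^'m \<Rightarrow> bool" where
  "null_asymptotically_stable J K L \<longleftrightarrow> null_stable J K L \<and>
     (\<exists>\<delta>>0. \<forall>z. second_order_solution J K L z \<and> norm (z 0) < \<delta> \<longrightarrow> (z \<longlongrightarrow> 0) at_top)"

definition null_unstable :: "real^'m^'m \<Rightarrow> real^'m^'m \<Rightarrow> real^'m^'m \<Rightarrow> bool" where
  "null_unstable J K L \<longleftrightarrow> \<not> null_stable J K L"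

end

theory Submission
  imports Defs "Jordan_Normal_Form.Jordan_Normal_Form_Existence" "HOL-Real_Asymp.Real_Asymp"
begin

text \<open>
  With \<open>\<xi> = J\<^sup>1\<^sup>/\<^sup>2 x\<close> the system reads \<open>\<xi>'' + A \<xi>' + B \<xi> = 0\<close>. Put
  \<open>\<Phi>(t) = exp (- t V / 2) C\<inverse> exp (t A / 2)\<close> and \<open>U = C V C\<inverse>\<close>. The commutator conditions
  (which extend to all \<open>n\<close> because the ambient matrix space has dimension \<open>m\<^sup>2\<close>) make
  \<open>exp (- t U / 2) exp (t A / 2)\<close> commute with \<open>B - A\<^sup>2 / 4\<close>, so \<open>\<Phi>\<close> intertwines
  \<open>B - A\<^sup>2 / 4\<close> with \<open>W - V\<^sup>2 / 4\<close>, and \<open>y = \<Phi> \<xi>\<close> solves \<open>y'' + V y' + W y = 0\<close>.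
  Since \<open>A\<close> commutes with its real part and \<open>A - A\<^sub>R\<close> is diagonalizable with purely imaginary
  eigenvalues, the condition \<open>C V\<^sub>R = A\<^sub>R C\<close> cancels the growing factors of \<open>\<Phi>\<close>: both \<open>\<Phi>\<close> and
  its inverse stay bounded, and stability of the two systems is equivalent. The damped system with
  \<open>V + V\<^sup>T > 0\<close> and \<open>W\<close> symmetric and nonsingular has, for small \<open>\<epsilon> > 0\<close>, the strict Lyapunov function
  \<open>F = |y'|\<^sup>2 + y \<bullet> W y + 2 \<epsilon> y' \<bullet> W y\<close>, whose derivative is at most \<open>- k (|y|\<^sup>2 + |y'|\<^sup>2)\<close>. It decays
  exponentially if \<open>W > 0\<close>; if it starts negative, it tends to \<open>-\<infinity>\<close> exponentially.
\<close>

no_notation Matrix.vec_index (infixl "$" 100)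
no_notation Matrix.scalar_prod (infix "\<bullet>" 70)
hide_const (open) Matrix.mat Matrix.row Matrix.col Matrix.vec Determinant.det VectorSpace.subspace

section \<open>The Banach algebra of bounded operators\<close>

text \<open>
  A copy of \<open>'a \<Rightarrow>\<^sub>L 'a\<close>: the type \<open>'a \<Rightarrow>\<^sub>L 'b\<close> itself cannot be an instance of \<open>real_normed_algebra_1\<close>,
  which is what the generic exponential needs.
\<close>

typedef (overloaded) 'a endo = "UNIV :: ('a::real_normed_vector \<Rightarrow>\<^sub>L 'a) set"
  by simp

setup_lifting type_definition_endo

instantiation endo :: (real_normed_vector) real_normed_vector
begin

lift_definition zero_endo :: "'a endo" is 0 .
lift_definition plus_endo :: "'a endo \<Rightarrow> 'a endo \<Rightarrow> 'a endo" is "(+)" .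
lift_definition minus_endo :: "'a endo \<Rightarrow> 'a endo \<Rightarrow> 'a endo" is "(-)" .
lift_definition uminus_endo :: "'a endo \<Rightarrow> 'a endo" is uminus .
lift_definition scaleR_endo :: "real \<Rightarrow> 'a endo \<Rightarrow> 'a endo" is scaleR .
lift_definition norm_endo :: "'a endo \<Rightarrow> real" is norm .
lift_definition sgn_endo :: "'a endo \<Rightarrow> 'a endo" is sgn .
lift_definition dist_endo :: "'a endo \<Rightarrow> 'a endo \<Rightarrow> real" is dist .

definition uniformity_endo :: "('a endo \<times> 'a endo) filter" where
  "uniformity_endo = (INF e\<in>{0<..}. principal {(x, y). dist x y < e})"

definition open_endo :: "'a endo set \<Rightarrow> bool" where
  "open_endo S \<longleftrightarrow> (\<forall>x\<in>S. \<forall>\<^sub>F (x', y) in uniformity. x' = x \<longrightarrow> y \<in> S)"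

instance
proof
  fix x y z :: "'a endo" and a b :: real
  show "x + y + z = x + (y + z)" by transfer (rule add.assoc)
  show "x + y = y + x" by transfer (rule add.commute)
  show "0 + x = x" by transfer (rule add_0)
  show "- x + x = 0" by transfer (rule left_minus)
  show "x - y = x + - y" by transfer simp
  show "a *\<^sub>R (x + y) = a *\<^sub>R x + a *\<^sub>R y" by transfer (rule scaleR_add_right)
  show "(a + b) *\<^sub>R x = a *\<^sub>R x + b *\<^sub>R x" by transfer (rule scaleR_add_left)
  show "a *\<^sub>R b *\<^sub>R x = (a * b) *\<^sub>R x" by transfer simp
  show "1 *\<^sub>R x = x" by transfer simp
  show "dist x y = norm (x - y)" by transfer (rule dist_norm)
  show "sgn x = inverse (norm x) *\<^sub>R x" by transfer (rule sgn_div_norm)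
  show "norm x = 0 \<longleftrightarrow> x = 0" by transfer simp
  show "norm (x + y) \<le> norm x + norm y" by transfer (rule norm_triangle_ineq)
  show "norm (a *\<^sub>R x) = \<bar>a\<bar> * norm x" by transfer simp
qed (simp_all only: uniformity_endo_def open_endo_def)

end

text \<open>The sort \<open>perfect_space\<close> excludes the zero space, on which the identity
  would equal zero and have norm 0.\<close>

instantiation endo :: ("{real_normed_vector, perfect_space}") real_normed_algebra_1
begin

lift_definition one_endo :: "'a endo" is id_blinfun .
lift_definition times_endo :: "'a endo \<Rightarrow> 'a endo \<Rightarrow> 'a endo" is "(o\<^sub>L)" .

instance
proof
  show "norm (x * y) \<le> norm x * norm y" for x y :: "'a endo"
    by transfer (rule norm_blinfun_compose)
  show "norm (1 :: 'a endo) = 1"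
    by transfer (rule norm_blinfun_id)
  show "(0 :: 'a endo) \<noteq> 1"
    by transfer (metis norm_blinfun_id norm_zero zero_neq_one)
qed (transfer, rule blinfun_eqI, simp add: blinfun.bilinear_simps)+

end

lemma Cauchy_endo: "Cauchy X \<longleftrightarrow> Cauchy (\<lambda>n. Rep_endo (X n))"
  unfolding Cauchy_def by transfer simp

instance endo :: ("{banach, perfect_space}") banach
proof
  fix X :: "nat \<Rightarrow> 'a endo"
  assume "Cauchy X"
  then obtain L where "(\<lambda>n. Rep_endo (X n)) \<longlonglongrightarrow> L"
    by (auto simp: Cauchy_endo Cauchy_convergent_iff convergent_def)
  then have "X \<longlonglongrightarrow> Abs_endo L"
    by (simp add: LIMSEQ_def dist_endo.rep_eq Abs_endo_inverse)
  then show "convergent X"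
    by (auto simp: convergent_def)
qed

lift_definition app :: "'a::real_normed_vector endo \<Rightarrow> 'a \<Rightarrow> 'a" (infixr "\<bullet>\<bullet>" 75) is blinfun_apply .

interpretation app: bounded_bilinear "app :: 'a::real_normed_vector endo \<Rightarrow> 'a \<Rightarrow> 'a"
proof
  show "\<exists>K. \<forall>(f :: 'a endo) x. norm (f \<bullet>\<bullet> x) \<le> norm f * norm x * K"
    by (intro exI[of _ 1], transfer, simp add: norm_blinfun)
qed (transfer, simp add: blinfun.bilinear_simps)+

lemma norm_app: "norm (f \<bullet>\<bullet> x) \<le> norm f * norm x"
  by transfer (rule norm_blinfun)

lemma app_one [simp]: "1 \<bullet>\<bullet> x = x"
  by transfer simp

lemma app_times [simp]: "(f * g) \<bullet>\<bullet> x = f \<bullet>\<bullet> g \<bullet>\<bullet> x"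
  by transfer simp

lemma endo_eqI: "(\<And>x. f \<bullet>\<bullet> x = g \<bullet>\<bullet> x) \<Longrightarrow> f = g"
  by transfer (rule blinfun_eqI)

definition endo_of :: "('a::real_normed_vector \<Rightarrow> 'a) \<Rightarrow> 'a endo" where
  "endo_of f = Abs_endo (Blinfun f)"

lemma app_endo_of [simp]: "bounded_linear f \<Longrightarrow> endo_of f \<bullet>\<bullet> x = f x"
  by (simp add: app.rep_eq endo_of_def Abs_endo_inverse bounded_linear_Blinfun_apply)

text \<open>By induction the relation passes to all powers, hence term by term to the two
  exponential series.\<close>

lemma exp_intertwine:
  fixes x y c :: "'a::{real_normed_algebra_1, banach}"
  assumes "x * c = c * y"
  shows "exp x * c = c * exp y"
proof -
  have "x ^ n * c = c * y ^ n" for n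
  proof (induction n)
    case (Suc n)
    have "x ^ Suc n * c = x * (x ^ n * c)"
      by (simp add: mult.assoc)
    also have "\<dots> = c * y ^ Suc n"
      by (simp add: Suc mult.assoc[symmetric] assms)
    finally show ?case .
  qed simp
  then have eq: "(\<lambda>n. (x ^ n /\<^sub>R fact n) * c) = (\<lambda>n. c * (y ^ n /\<^sub>R fact n))"
    by simp
  have "(\<lambda>n. (x ^ n /\<^sub>R fact n) * c) sums (exp x * c)"
    by (intro sums_mult2 exp_converges)
  moreover have "(\<lambda>n. c * (y ^ n /\<^sub>R fact n)) sums (c * exp y)"
    by (intro sums_mult exp_converges)
  ultimately show ?thesis
    unfolding eq by (rule sums_unique2)
qed

lemma exp_neg_cancel [simp]:
  fixes x :: "'a::{real_normed_algebra_1, banach}"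
  shows "exp (- x) * exp x = 1" "exp x * exp (- x) = 1"
  using exp_minus_inverse[of "- x"] exp_minus_inverse[of x] by simp_all

text \<open>The partial sums of the series applied to \<open>x\<close> stay in \<open>S\<close>, and
  closedness keeps the limit there. Later \<open>S\<close> is a centralizer.\<close>

lemma exp_app_subspace:
  fixes T :: "'a::{banach, perfect_space} endo"
  assumes S: "subspace S" "closed S" and T: "\<And>x. x \<in> S \<Longrightarrow> T \<bullet>\<bullet> x \<in> S" and x: "x \<in> S"
  shows "exp T \<bullet>\<bullet> x \<in> S"
proof -
  have "T ^ n \<bullet>\<bullet> x \<in> S" for n
    by (induction n) (auto simp: x T)
  then have "(\<Sum>i<n. (T ^ i /\<^sub>R fact i) \<bullet>\<bullet> x) \<in> S" for n
    by (auto intro!: subspace_sum S subspace_scale[OF S(1)] simp: app.scaleR_left)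
  moreover have "(\<lambda>n. (T ^ n /\<^sub>R fact n) \<bullet>\<bullet> x) sums (exp T \<bullet>\<bullet> x)"
    by (rule bounded_linear.sums[OF app.bounded_linear_left exp_converges])
  ultimately show ?thesis
    using S(2) unfolding sums_def closed_sequential_limits by (metis (no_types, lifting))
qed

section \<open>The real part of a matrix\<close>

lemma mult_mat_entry:
  assumes "A \<in> carrier_mat n n" "B \<in> carrier_mat n n" "i < n" "j < n"
  shows "(A * B) $$ (i, j) = (\<Sum>k<n. A $$ (i, k) * B $$ (k, j))"
  using assms by (auto simp: scalar_prod_def lessThan_atLeast0 intro!: sum.cong)

lemma sum_list_fst_map [simp]: "sum_list (map fst (map (\<lambda>(p, z). (p, f z)) bs)) = sum_list (map fst bs)"
  by (induction bs) auto

lemma jordan_matrix_Cons_entry: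
  assumes "i < p + sum_list (map fst bs)" "k < p + sum_list (map fst bs)"
  shows "jordan_matrix ((p, z) # bs) $$ (i, k) =
    (if i < p \<and> k < p then if i = k then z else if Suc i = k then 1 else 0
     else if p \<le> i \<and> p \<le> k then jordan_matrix bs $$ (i - p, k - p) else 0)"
  using assms unfolding jordan_matrix_Cons by (subst index_mat_four_block) auto

lemma jordan_matrix_nonzero_entry:
  assumes "i < sum_list (map fst bs)" "k < sum_list (map fst bs)" "jordan_matrix bs $$ (i, k) \<noteq> 0"
  shows "i \<le> k \<and> jordan_matrix bs $$ (i, i) = jordan_matrix bs $$ (k, k)"
  using assms
proof (induction bs arbitrary: i k)
  case (Cons b bs)
  obtain p z where b: "b = (p, z)"
    by fastforce
  have lt: "i < p + sum_list (map fst bs)" "k < p + sum_list (map fst bs)"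
    using Cons.prems by (simp_all add: b)
  note entries = jordan_matrix_Cons_entry[OF lt, of z] jordan_matrix_Cons_entry[OF lt(1) lt(1), of z]
    jordan_matrix_Cons_entry[OF lt(2) lt(2), of z]
  show ?case
  proof (cases "p \<le> i \<and> p \<le> k")
    case True
    then have "i - p \<le> k - p \<and> jordan_matrix bs $$ (i - p, i - p) = jordan_matrix bs $$ (k - p, k - p)"
      using Cons.prems(3) lt unfolding b entries by (intro Cons.IH) auto
    with True show ?thesis
      unfolding b entries by auto
  next
    case False
    with Cons.prems(3) show ?thesis
      unfolding b entries by (simp split: if_splits)
  qed
qed simp

lemma jordan_matrix_map_entry:
  assumes "i < sum_list (map fst bs)" "j < sum_list (map fst bs)"
  shows "jordan_matrix (map (\<lambda>(p, z). (p, f z)) bs) $$ (i, j) =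
    (if i = j then f (jordan_matrix bs $$ (i, j)) else jordan_matrix bs $$ (i, j))"
  using assms
proof (induction bs arbitrary: i j)
  case (Cons b bs)
  obtain p z where b: "b = (p, z)"
    by fastforce
  have lt: "i < p + sum_list (map fst bs)" "j < p + sum_list (map fst bs)"
    using Cons.prems by (simp_all add: b)
  then have lt': "i < p + sum_list (map fst (map (\<lambda>(p, z). (p, f z)) bs))"
    "j < p + sum_list (map fst (map (\<lambda>(p, z). (p, f z)) bs))"
    unfolding sum_list_fst_map .
  show ?case
    unfolding b list.map prod.case jordan_matrix_Cons_entry[OF lt] jordan_matrix_Cons_entry[OF lt']
    using Cons.IH[of "i - p" "j - p"] lt by auto
qed simp

text \<open>
  Off-diagonal nonzero entries of a Jordan matrix lie above the diagonal and link equal eigenvalues, so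
  entry \<open>(i, j)\<close> of the intertwining equation involves, apart from \<open>X $$ (i, j)\<close>, only entries of \<open>X\<close> further
  down or to the left that belong to the same pair of eigenvalues.
\<close>

lemma jordan_intertwiner_entry:
  fixes bs cs :: "(nat \<times> 'a::field) list"
  assumes n: "sum_list (map fst bs) = n" "sum_list (map fst cs) = n" "X \<in> carrier_mat n n"
    and eq: "jordan_matrix bs * X = X * jordan_matrix cs"
    and ij: "i < n" "j < n" "X $$ (i, j) \<noteq> 0"
  shows "jordan_matrix bs $$ (i, i) = jordan_matrix cs $$ (j, j)"
  using ij
proof (induction "n - i + j" arbitrary: i j rule: less_induct)
  case less
  let ?J = "jordan_matrix bs" and ?K = "jordan_matrix cs"
  note [simp] = jordan_matrix_carrier[of bs, unfolded n] jordan_matrix_carrier[of cs, unfolded n]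
  show ?case
  proof (rule ccontr)
    assume ne: "?J $$ (i, i) \<noteq> ?K $$ (j, j)"
    have J: "?J $$ (i, k) * X $$ (k, j) = 0" if "k < n" "k \<noteq> i" for k
    proof (rule ccontr)
      assume *: "?J $$ (i, k) * X $$ (k, j) \<noteq> 0"
      then have "i \<le> k" "?J $$ (i, i) = ?J $$ (k, k)"
        using jordan_matrix_nonzero_entry[of i bs k] that less.prems n by auto
      with that less.prems have "n - k + j < n - i + j"
        by simp
      from less.hyps[OF this] * that less.prems ne \<open>?J $$ (i, i) = ?J $$ (k, k)\<close> show False
        by auto
    qed
    have K: "X $$ (i, k) * ?K $$ (k, j) = 0" if "k < n" "k \<noteq> j" for k
    proof (rule ccontr)
      assume *: "X $$ (i, k) * ?K $$ (k, j) \<noteq> 0"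
      then have "k \<le> j" "?K $$ (k, k) = ?K $$ (j, j)"
        using jordan_matrix_nonzero_entry[of k cs j] that less.prems n by auto
      with that have "n - i + k < n - i + j"
        by simp
      from less.hyps[OF this] * that less.prems ne \<open>?K $$ (k, k) = ?K $$ (j, j)\<close> show False
        by auto
    qed
    have "(?J * X) $$ (i, j) = ?J $$ (i, i) * X $$ (i, j)"
      using less.prems n(3) J
      by (simp add: mult_mat_entry[of _ n] sum.remove[of "{..<n}" i] sum.neutral del: index_mult_mat mult_eq_0_iff)
    moreover have "(X * ?K) $$ (i, j) = X $$ (i, j) * ?K $$ (j, j)"
      using less.prems n(3) K
      by (simp add: mult_mat_entry[of _ n] sum.remove[of "{..<n}" j] sum.neutral del: index_mult_mat mult_eq_0_iff)
    ultimately show False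
      using eq ne less.prems by simp
  qed
qed

abbreviation re_blocks :: "(nat \<times> complex) list \<Rightarrow> (nat \<times> complex) list" where
  "re_blocks bs \<equiv> map (\<lambda>(p, z). (p, complex_of_real (Re z))) bs"

text \<open>Passing to real parts subtracts i Im only on the diagonals. Entry (i, j) of the left
  product loses i Im(J_ii) X_ij and that of the right product loses X_ij i Im(K_jj); these agree
  because a nonzero X_ij forces J_ii = K_jj.\<close>

lemma jordan_intertwiner_re_blocks:
  assumes n: "sum_list (map fst bs) = n" "sum_list (map fst cs) = n" "X \<in> carrier_mat n n"
    and eq: "jordan_matrix bs * X = X * jordan_matrix cs"
  shows "jordan_matrix (re_blocks bs) * X = X * jordan_matrix (re_blocks cs)"
proof (rule eq_matI)
  let ?J = "jordan_matrix bs" and ?K = "jordan_matrix cs"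
  have c: "?J \<in> carrier_mat n n" "?K \<in> carrier_mat n n"
    "jordan_matrix (re_blocks bs) \<in> carrier_mat n n" "jordan_matrix (re_blocks cs) \<in> carrier_mat n n"
    using n jordan_matrix_carrier by (metis sum_list_fst_map)+
  fix i j
  assume "i < dim_row (X * jordan_matrix (re_blocks cs))" "j < dim_col (X * jordan_matrix (re_blocks cs))"
  then have ij: "i < n" "j < n"
    using n c by auto
  have "(jordan_matrix (re_blocks bs) * X) $$ (i, j)
      = (\<Sum>k<n. ?J $$ (i, k) * X $$ (k, j) - (if k = i then \<i> * Im (?J $$ (i, i)) * X $$ (i, j) else 0))"
    unfolding mult_mat_entry[OF c(3) n(3) ij]
  proof (rule sum.cong)
    fix k assume "k \<in> {..<n}"
    with ij n have "jordan_matrix (re_blocks bs) $$ (i, k)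
        = ?J $$ (i, k) - (if k = i then \<i> * Im (?J $$ (i, i)) else 0)"
      by (auto simp: jordan_matrix_map_entry complex_eq_iff)
    then show "jordan_matrix (re_blocks bs) $$ (i, k) * X $$ (k, j)
        = ?J $$ (i, k) * X $$ (k, j) - (if k = i then \<i> * Im (?J $$ (i, i)) * X $$ (i, j) else 0)"
      by (simp add: left_diff_distrib)
  qed simp
  then have "(jordan_matrix (re_blocks bs) * X) $$ (i, j)
      = (?J * X) $$ (i, j) - \<i> * Im (?J $$ (i, i)) * X $$ (i, j)"
    using ij by (simp only: mult_mat_entry[OF c(1) n(3) ij] sum_subtractf sum.delta finite_lessThan lessThan_iff if_True)
  moreover have "(X * jordan_matrix (re_blocks cs)) $$ (i, j)
      = (\<Sum>k<n. X $$ (i, k) * ?K $$ (k, j) - (if k = j then X $$ (i, j) * (\<i> * Im (?K $$ (j, j))) else 0))"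
    unfolding mult_mat_entry[OF n(3) c(4) ij]
  proof (rule sum.cong)
    fix k assume "k \<in> {..<n}"
    with ij n have "jordan_matrix (re_blocks cs) $$ (k, j)
        = ?K $$ (k, j) - (if k = j then \<i> * Im (?K $$ (j, j)) else 0)"
      by (auto simp: jordan_matrix_map_entry complex_eq_iff)
    then show "X $$ (i, k) * jordan_matrix (re_blocks cs) $$ (k, j)
        = X $$ (i, k) * ?K $$ (k, j) - (if k = j then X $$ (i, j) * (\<i> * Im (?K $$ (j, j))) else 0)"
      by (simp add: right_diff_distrib)
  qed simp
  then have "(X * jordan_matrix (re_blocks cs)) $$ (i, j)
      = (X * ?K) $$ (i, j) - X $$ (i, j) * (\<i> * Im (?K $$ (j, j)))"
    using ij by (simp only: mult_mat_entry[OF n(3) c(2) ij] sum_subtractf sum.delta finite_lessThan lessThan_iff if_True)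
  moreover have "X $$ (i, j) \<noteq> 0 \<Longrightarrow> ?J $$ (i, i) = ?K $$ (j, j)"
    by (rule jordan_intertwiner_entry[OF n eq ij])
  ultimately show "(jordan_matrix (re_blocks bs) * X) $$ (i, j) = (X * jordan_matrix (re_blocks cs)) $$ (i, j)"
    unfolding eq by (cases "X $$ (i, j) = 0") (simp_all del: index_mult_mat)
next
  show "dim_row (jordan_matrix (re_blocks bs) * X) = dim_row (X * jordan_matrix (re_blocks cs))"
    "dim_col (jordan_matrix (re_blocks bs) * X) = dim_col (X * jordan_matrix (re_blocks cs))"
    using n by (auto simp del: map_map)
qed

lemma jordan_matrix_offdiag:
  assumes "i < sum_list (map fst bs)" "j < sum_list (map fst bs)" "i \<noteq> j"
  shows "jordan_matrix bs $$ (i, j) \<in> {0, 1}"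
  using assms
proof (induction bs arbitrary: i j)
  case (Cons b bs)
  obtain p z where b: "b = (p, z)"
    by fastforce
  have lt: "i < p + sum_list (map fst bs)" "j < p + sum_list (map fst bs)"
    using Cons.prems by (simp_all add: b)
  show ?case
    unfolding b jordan_matrix_Cons_entry[OF lt] using Cons.IH[of "i - p" "j - p"] Cons.prems(3) lt by auto
qed simp

section \<open>Uniqueness, commutation and conjugation of the real part over the complex
  numbers\<close>

definition complex_real_part :: "complex Matrix.mat \<Rightarrow> complex Matrix.mat \<Rightarrow> bool" where
  "complex_real_part A R \<longleftrightarrow> (\<exists>T T' bs. similar_mat_wit A (jordan_matrix bs) T T' \<and>
     similar_mat_wit R (jordan_matrix (re_blocks bs)) T T')"

lemma mat_cancel_left:
  fixes P Q M :: "'a::semiring_1 mat"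
  assumes "P * Q = 1\<^sub>m n" "P \<in> carrier_mat n n" "Q \<in> carrier_mat n n" "M \<in> carrier_mat n n"
  shows "P * (Q * M) = M"
  by (simp only: assoc_mult_mat[OF assms(2-4), symmetric] assms(1) left_mult_one_mat[OF assms(4)])

text \<open>Two Jordan decompositions of \<open>A\<close> are linked by X = S' T, which intertwines
  the two Jordan matrices. It then also intertwines their real versions, and this carries
  \<open>R\<close> into \<open>R'\<close>.\<close>

lemma complex_real_part_unique:
  assumes "complex_real_part A R" "complex_real_part A R'"
  shows "R = R'"
proof -
  define n where "n = dim_row A"
  obtain S S' bs where S: "similar_mat_wit A (jordan_matrix bs) S S'"
      "similar_mat_wit R (jordan_matrix (re_blocks bs)) S S'"
    using assms(1) unfolding complex_real_part_def by blast
  obtain T T' cs where T: "similar_mat_wit A (jordan_matrix cs) T T'"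
      "similar_mat_wit R' (jordan_matrix (re_blocks cs)) T T'"
    using assms(2) unfolding complex_real_part_def by blast
  note S1 = similar_mat_witD[OF n_def S(1)] and T1 = similar_mat_witD[OF n_def T(1)]
  have "n = dim_row R" "n = dim_row R'"
    using S1 T1 similar_mat_witD(6)[OF refl S(2)] similar_mat_witD(6)[OF refl T(2)] by auto
  note S2 = similar_mat_witD[OF this(1) S(2)] and T2 = similar_mat_witD[OF this(2) T(2)]
  have n: "sum_list (map fst bs) = n" "sum_list (map fst cs) = n"
    using carrier_matD(1)[OF S1(5)] carrier_matD(1)[OF T1(5)] by auto
  note simps = S1(1,2,4-7) S2(4,5) T1(1,2,4-7) T2(4,5) assoc_mult_mat[of _ n n _ n _ n]
    mult_carrier_mat[of _ n n _ n] left_mult_one_mat[of _ n n] right_mult_one_mat[of _ n n]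
    mat_cancel_left[OF S1(1)] mat_cancel_left[OF S1(2)] mat_cancel_left[OF T1(1)] mat_cancel_left[OF T1(2)]
  have X: "S' * T \<in> carrier_mat n n"
    by (simp only: simps)
  have "jordan_matrix bs * (S' * T) = S' * A * T"
    by (subst S1(3)) (simp only: simps)
  also have "\<dots> = S' * T * jordan_matrix cs"
    by (subst T1(3)) (simp only: simps)
  finally have eq: "jordan_matrix (re_blocks bs) * (S' * T) = S' * T * jordan_matrix (re_blocks cs)"
    using jordan_intertwiner_re_blocks[OF n X] by blast
  have "R = S * (jordan_matrix (re_blocks bs) * (S' * T)) * T'"
    by (subst S2(3)) (simp only: simps)
  also have "\<dots> = R'"
    unfolding eq by (subst T2(3)) (simp only: simps)
  finally show ?thesis .
qed

text \<open>A Jordan matrix intertwines itself with itself; taking it as the intertwiner shows that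
  it commutes with its real version. Conjugation by \<open>S\<close> transfers this to
  \<open>A\<close> and \<open>R\<close>.\<close>

lemma complex_real_part_commute:
  assumes "complex_real_part A R"
  shows "A * R = R * A"
proof -
  define n where "n = dim_row A"
  obtain S S' bs where S: "similar_mat_wit A (jordan_matrix bs) S S'"
      "similar_mat_wit R (jordan_matrix (re_blocks bs)) S S'"
    using assms(1) unfolding complex_real_part_def by blast
  note S1 = similar_mat_witD[OF n_def S(1)]
  have "n = dim_row R"
    using S1 similar_mat_witD(6)[OF refl S(2)] by auto
  note S2 = similar_mat_witD[OF this S(2)]
  note simps = S1(1,2,4-7) S2(4,5) assoc_mult_mat[of _ n n _ n _ n]
    mult_carrier_mat[of _ n n _ n] mat_cancel_left[OF S1(2)]
  have eq: "jordan_matrix (re_blocks bs) * jordan_matrix bs = jordan_matrix bs * jordan_matrix (re_blocks bs)"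
    using carrier_matD(1)[OF S1(5)] by (intro jordan_intertwiner_re_blocks[of _ n] S1(5)) auto
  have "A * R = S * (jordan_matrix bs * jordan_matrix (re_blocks bs)) * S'"
    by (subst S1(3), subst S2(3)) (simp only: simps)
  also have "\<dots> = R * A"
    unfolding eq[symmetric] by (subst S1(3), subst S2(3)) (simp only: simps)
  finally show ?thesis .
qed

text \<open>Conjugate the transforming matrices and the eigenvalues: the superdiagonal ones are
  fixed and the real parts do not change. Together with uniqueness this makes the real part of a
  real matrix real.\<close>

lemma complex_real_part_conjugate:
  assumes "complex_real_part A R"
  shows "complex_real_part (map_mat cnj A) (map_mat cnj R)"
proof -
  interpret cnj: comm_ring_hom cnj
    by unfold_locales (simp_all add: complex_eq_iff)
  have map: "map_mat cnj (jordan_matrix bs) = jordan_matrix (map (\<lambda>(p, z). (p, cnj z)) bs)" for bs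
  proof (rule eq_matI, unfold index_map_mat jordan_matrix_dim sum_list_fst_map)
    fix i j
    assume ij: "i < sum_list (map fst bs)" "j < sum_list (map fst bs)"
    have "cnj (jordan_matrix bs $$ (i, j)) = jordan_matrix bs $$ (i, j)" if "i \<noteq> j"
      using jordan_matrix_offdiag[OF ij that] by auto
    with ij show "cnj.mat_hom (jordan_matrix bs) $$ (i, j) = jordan_matrix (map (\<lambda>(p, z). (p, cnj z)) bs) $$ (i, j)"
      unfolding jordan_matrix_map_entry[OF ij] by auto
  qed (simp_all only: index_map_mat jordan_matrix_dim sum_list_fst_map)
  have sim: "similar_mat_wit (map_mat cnj M) (map_mat cnj N) (map_mat cnj P) (map_mat cnj Q)"
    if "similar_mat_wit M N P Q" for M N P Q
  proof -
    note D = similar_mat_witD[OF refl that]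
    show ?thesis
    proof (rule similar_mat_witI)
      show "map_mat cnj P * map_mat cnj Q = 1\<^sub>m (dim_row M)"
        by (simp only: D(1) cnj.mat_hom_mult[OF D(6,7), symmetric] cnj.mat_hom_one)
      show "map_mat cnj Q * map_mat cnj P = 1\<^sub>m (dim_row M)"
        by (simp only: D(2) cnj.mat_hom_mult[OF D(7,6), symmetric] cnj.mat_hom_one)
      show "map_mat cnj M = map_mat cnj P * map_mat cnj N * map_mat cnj Q"
        by (subst D(3)) (simp only: cnj.mat_hom_mult[OF mult_carrier_mat[OF D(6,5)] D(7)] cnj.mat_hom_mult[OF D(6,5)])
    qed (use D(4-7) in \<open>simp_all only: map_carrier_mat\<close>)
  qed
  obtain S S' bs where S: "similar_mat_wit A (jordan_matrix bs) S S'"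
      "similar_mat_wit R (jordan_matrix (re_blocks bs)) S S'"
    using assms(1) unfolding complex_real_part_def by blast
  have "re_blocks (map (\<lambda>(p, z). (p, cnj z)) bs) = map (\<lambda>(p, z). (p, cnj z)) (re_blocks bs)"
    by (induction bs) auto
  then show ?thesis
    using sim[OF S(1)] sim[OF S(2)] unfolding complex_real_part_def map by metis
qed

section \<open>Passage between real matrices and the matrices that carry Jordan forms\<close>

abbreviation idx :: "nat \<Rightarrow> 'm::finite" where
  "idx \<equiv> from_nat_into UNIV"

lemma bij_betw_idx: "bij_betw (idx :: nat \<Rightarrow> 'm::finite) {..<CARD('m)} UNIV"
  using bij_betw_from_nat_into_finite[of "UNIV :: 'm set"] by simp

lemma sum_idx: "(\<Sum>k<CARD('m). f (idx k :: 'm::finite)) = (\<Sum>i\<in>UNIV. f i)"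
  by (rule sum.reindex_bij_betw[OF bij_betw_idx])

lemma ex_idx: "\<exists>k<CARD('m). idx k = (i :: 'm::finite)"
  using bij_betw_idx[where 'm = 'm] unfolding bij_betw_def by (metis UNIV_I imageE lessThan_iff)

lemma complex_mat_carrier [simp]: "complex_mat (A :: real^'m^'m) \<in> carrier_mat CARD('m) CARD('m)"
  by (simp add: complex_mat_def)

lemma complex_mat_entry [simp]:
  "i < CARD('m) \<Longrightarrow> j < CARD('m) \<Longrightarrow> complex_mat (A :: real^'m^'m) $$ (i, j) = complex_of_real (A $ idx i $ idx j)"
  by (simp add: complex_mat_def)

lemma complex_mat_dim [simp]:
  "dim_row (complex_mat (A :: real^'m^'m)) = CARD('m)" "dim_col (complex_mat A) = CARD('m)"
  by (simp_all add: complex_mat_def)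

lemma complex_mat_inj:
  fixes A B :: "real^'m^'m"
  assumes eq: "complex_mat A = complex_mat B"
  shows "A = B"
proof -
  have "A $ i $ j = B $ i $ j" for i j
  proof -
    obtain k l where "k < CARD('m)" "idx k = i" "l < CARD('m)" "idx l = j"
      using ex_idx by metis
    then show ?thesis
      using complex_mat_entry[of k l A] complex_mat_entry[of k l B] eq by (metis of_real_eq_iff)
  qed
  then show "A = B"
    by (simp add: vec_eq_iff)
qed

lemma complex_mat_mult: "complex_mat (A ** B) = complex_mat A * complex_mat (B :: real^'m^'m)"
proof (rule eq_matI)
  fix i j
  assume "i < dim_row (complex_mat A * complex_mat B)" "j < dim_col (complex_mat A * complex_mat B)"
  then have ij: "i < CARD('m)" "j < CARD('m)"
    by auto
  have "(complex_mat A * complex_mat B) $$ (i, j)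
      = (\<Sum>k<CARD('m). complex_of_real (A $ idx i $ idx k) * complex_of_real (B $ idx k $ idx j))"
    unfolding mult_mat_entry[OF complex_mat_carrier complex_mat_carrier ij]
    using ij by (intro sum.cong) simp_all
  also have "\<dots> = (\<Sum>k\<in>UNIV. complex_of_real (A $ idx i $ k) * complex_of_real (B $ k $ idx j))"
    by (rule sum_idx)
  also have "\<dots> = complex_mat (A ** B) $$ (i, j)"
    using ij by (simp add: matrix_matrix_mult_def)
  finally show "complex_mat (A ** B) $$ (i, j) = (complex_mat A * complex_mat B) $$ (i, j)" ..
qed simp_all

lemma is_real_part_imp:
  assumes "is_real_part A R"
  shows "complex_real_part (complex_mat A) (complex_mat R)"
  using assms unfolding is_real_part_def complex_real_part_def by blast

text \<open>A Jordan form over the complex numbers yields a candidate \<open>Rc\<close>. Conjugation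
  fixes the real matrix \<open>A\<close>, so by uniqueness it fixes \<open>Rc\<close>, whose entries
  are therefore real.\<close>

lemma is_real_part_exists: "\<exists>R. is_real_part (A :: real^'m^'m) R"
proof -
  let ?n = "CARD('m)" and ?A = "complex_mat A"
  obtain bs T T' where bs: "0 \<notin> fst ` set bs" and T: "similar_mat_wit ?A (jordan_matrix bs) T T'"
    using jordan_nf_exists[OF complex_mat_carrier[of A]] char_poly_factorized[OF complex_mat_carrier[of A]]
    unfolding jordan_nf_def similar_mat_def by metis
  note T1 = similar_mat_witD2[OF complex_mat_carrier T]
  define Rc where "Rc = T * jordan_matrix (re_blocks bs) * T'"
  have J: "jordan_matrix (re_blocks bs) \<in> carrier_mat ?n ?n"
    using carrier_matD(1)[OF T1(5)] jordan_matrix_carrier[of "re_blocks bs"]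
    unfolding sum_list_fst_map by simp
  have Rc: "Rc \<in> carrier_mat ?n ?n"
    unfolding Rc_def by (rule mult_carrier_mat[OF mult_carrier_mat[OF T1(6) J] T1(7)])
  have R: "similar_mat_wit Rc (jordan_matrix (re_blocks bs)) T T'"
    by (rule similar_mat_witI[OF T1(1,2) Rc_def Rc J T1(6,7)])
  then have crp: "complex_real_part ?A Rc"
    unfolding complex_real_part_def using T by blast
  have "map_mat cnj ?A = ?A"
    by (rule eq_matI) simp_all
  with complex_real_part_conjugate[OF crp] have "map_mat cnj Rc = Rc"
    using complex_real_part_unique crp by metis
  then have real: "cnj (Rc $$ (i, j)) = Rc $$ (i, j)" if "i < ?n" "j < ?n" for i j
    using index_map_mat(1)[of i Rc j cnj] Rc that by simp
  \<comment> \<open>The inverse of the enumeration on the initial segment carries the indices of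
    \<open>Rc\<close> back to the index type.\<close>
  define e where "e = the_inv_into {..<?n} (idx :: nat \<Rightarrow> 'm)"
  have e: "e (idx k) = k" if "k < ?n" for k
    unfolding e_def using that bij_betw_imp_inj_on[OF bij_betw_idx[where 'm = 'm]] by (simp add: the_inv_into_f_f)
  define R where "R = (\<chi> i j. Re (Rc $$ (e i, e j)))"
  have Rc_eq: "complex_mat R = Rc"
  proof (rule eq_matI)
    fix i j
    assume "i < dim_row Rc" "j < dim_col Rc"
    with Rc have ij: "i < ?n" "j < ?n"
      by auto
    have "complex_of_real (Re (Rc $$ (i, j))) = Rc $$ (i, j)"
      using real[OF ij] by (metis Reals_cnj_iff of_real_Re)
    with ij show "complex_mat R $$ (i, j) = Rc $$ (i, j)"
      by (simp add: R_def e)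
  qed (use Rc in simp_all)
  have "is_real_part A R"
    unfolding is_real_part_def Rc_eq using bs T R by metis
  then show ?thesis ..
qed

lemma is_real_part_real_part: "is_real_part A (real_part A)"
proof -
  obtain R where R: "is_real_part A R"
    using is_real_part_exists by blast
  have unique: "R' = R" if R': "is_real_part A R'" for R'
    using complex_real_part_unique[OF is_real_part_imp[OF R'] is_real_part_imp[OF R]]
    by (rule complex_mat_inj)
  show ?thesis
    by (subst real_part_def) (rule theI[of "is_real_part A", OF R unique])
qed

lemma real_part_commute: "A ** real_part A = real_part A ** A"
  using complex_real_part_commute[OF is_real_part_imp[OF is_real_part_real_part[of A]]]
  unfolding complex_mat_mult[symmetric] by (rule complex_mat_inj)

section \<open>Boundedness of the imaginary exponential\<close>

text \<open>The functionals \<open>L k\<close> are left eigenvectors of \<open>M\<close> with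
  imaginary eigenvalues, so their moduli are constant along the flow; the last assumption recovers
  the norm from these moduli.\<close>

lemma exp_semisimple_bounded:
  fixes M :: "'a::{banach, perfect_space} endo" and L :: "nat \<Rightarrow> 'a \<Rightarrow> complex"
  assumes L: "\<And>k. k < n \<Longrightarrow> bounded_linear (L k)"
    and eigen: "\<And>k x. k < n \<Longrightarrow> L k (M \<bullet>\<bullet> x) = \<i> * of_real (\<beta> k) * L k x"
    and norm: "\<And>x. norm x \<le> r * (\<Sum>k<n. norm (L k x))"
  obtains c where "\<And>t x. norm (exp (t *\<^sub>R M) \<bullet>\<bullet> x) \<le> c * norm x"
proof -
  have const: "norm (L k (exp (t *\<^sub>R M) \<bullet>\<bullet> x)) = norm (L k x)" if k: "k < n" for k t x
  proof -
    let ?u = "\<lambda>t. L k (exp (t *\<^sub>R M) \<bullet>\<bullet> x)"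
    let ?e = "\<lambda>t. exp (t *\<^sub>R (- (\<i> * of_real (\<beta> k))))"
    \<comment> \<open>The factor \<open>?e\<close>, of modulus one, undoes the rotation of
      \<open>?u\<close>.\<close>
    have "((\<lambda>t. ?e t * ?u t) has_vector_derivative 0) (at t)" for t
    proof -
      have "((\<lambda>t. exp (t *\<^sub>R M) \<bullet>\<bullet> x) has_vector_derivative M \<bullet>\<bullet> exp (t *\<^sub>R M) \<bullet>\<bullet> x) (at t)"
        using bounded_linear.has_vector_derivative[OF app.bounded_linear_left[of x]
            exp_scaleR_has_vector_derivative_left[of M t]] by simp
      from bounded_linear.has_vector_derivative[OF L[OF k] this]
      have u: "(?u has_vector_derivative \<i> * of_real (\<beta> k) * ?u t) (at t)"
        by (simp add: eigen[OF k])
      have e: "(?e has_vector_derivative ?e t * - (\<i> * of_real (\<beta> k))) (at t)"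
        by (rule exp_scaleR_has_vector_derivative_right)
      show ?thesis
        using has_vector_derivative_mult[OF e u] by simp
    qed
    then have "\<And>t. ((\<lambda>t. ?e t * ?u t) has_vector_derivative 0) (at t within UNIV)"
      by simp
    then obtain d where d: "\<And>t. ?e t * ?u t = d"
      using has_vector_derivative_zero_constant[of UNIV "\<lambda>t. ?e t * ?u t"] by auto
    have "norm (?e t * ?u t) = norm (?e 0 * ?u 0)"
      unfolding d ..
    then show ?thesis
      by (simp add: norm_mult)
  qed
  have "\<exists>B. \<forall>x. norm (L k x) \<le> norm x * B" if "k < n" for k
    using bounded_linear.bounded[OF L[OF that]] .
  then obtain B where B: "\<And>k x. k < n \<Longrightarrow> norm (L k x) \<le> norm x * B k"
    by metis
  have "norm (exp (t *\<^sub>R M) \<bullet>\<bullet> x) \<le> (\<bar>r\<bar> * (\<Sum>k<n. B k)) * norm x" for t x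
  proof -
    have "norm (exp (t *\<^sub>R M) \<bullet>\<bullet> x) \<le> r * (\<Sum>k<n. norm (L k x))"
      using norm[of "exp (t *\<^sub>R M) \<bullet>\<bullet> x"] by (simp add: const)
    also have "\<dots> \<le> \<bar>r\<bar> * (\<Sum>k<n. norm (L k x))"
      by (intro mult_right_mono sum_nonneg) auto
    also have "\<dots> \<le> \<bar>r\<bar> * (\<Sum>k<n. norm x * B k)"
      by (intro mult_left_mono sum_mono) (auto simp: B)
    finally show ?thesis
      by (simp add: sum_distrib_left sum_distrib_right mult_ac)
  qed
  then show ?thesis
    by (rule that)
qed

section \<open>Real matrices as bounded operators\<close>

definition mop :: "real^'m^'m \<Rightarrow> (real^'m) endo" where
  "mop A = endo_of ((*v) A)"

lemma app_mop [simp]: "mop A \<bullet>\<bullet> x = A *v x"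
  by (simp add: mop_def matrix_vector_mul_bounded_linear)

lemma mop_mult: "mop (A ** B) = mop A * mop B"
  by (rule endo_eqI) (simp add: matrix_vector_mul_assoc)

lemma mop_add: "mop (A + B) = mop A + mop B"
  by (rule endo_eqI) (simp add: app.add_left matrix_vector_mult_add_rdistrib)

lemma mop_diff: "mop (A - B) = mop A - mop B"
  by (rule endo_eqI) (simp add: app.diff_left matrix_vector_mult_diff_rdistrib)

lemma mop_scaleR: "mop (c *\<^sub>R A) = c *\<^sub>R mop A"
  by (rule endo_eqI) (simp add: app.scaleR_left scaleR_matrix_vector_assoc)

lemma mop_one: "mop (mat 1) = 1"
  by (rule endo_eqI) simp

text \<open>The rows of \<open>T'\<close>, the inverse of \<open>T\<close>, are left eigenvectors of
  \<open>A - real_part A\<close>: the two Jordan matrices differ by a diagonal matrix with entries i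
  \<open>\<beta> k\<close>. Recovering x from the values \<open>L k x\<close> by means of
  \<open>T\<close> gives the norm estimate.\<close>

lemma exp_imaginary_part_bounded:
  fixes A :: "real^'m^'m"
  obtains c where "\<And>t x. norm (exp (t *\<^sub>R mop (A - real_part A)) \<bullet>\<bullet> x) \<le> c * norm x"
proof -
  let ?n = "CARD('m)" and ?A = "complex_mat A" and ?R = "complex_mat (real_part A)"
  obtain T T' bs where T: "similar_mat_wit ?A (jordan_matrix bs) T T'"
      "similar_mat_wit ?R (jordan_matrix (re_blocks bs)) T T'"
    using is_real_part_real_part[of A] unfolding is_real_part_def by blast
  note A = similar_mat_witD2[OF complex_mat_carrier T(1)] and R = similar_mat_witD2[OF complex_mat_carrier T(2)]
  have bs: "sum_list (map fst bs) = ?n"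
    using carrier_matD(1)[OF A(5)] by simp
  define L where "L k x = (\<Sum>l<?n. T' $$ (k, l) * complex_of_real (x $ idx l))" for k and x :: "real^'m"
  define \<beta> where "\<beta> k = Im (jordan_matrix bs $$ (k, k))" for k
  have T'A: "T' * ?A = jordan_matrix bs * T'" and T'R: "T' * ?R = jordan_matrix (re_blocks bs) * T'"
    by (subst A(3) R(3), simp only: assoc_mult_mat[of _ ?n ?n _ ?n _ ?n] mult_carrier_mat[of _ ?n ?n _ ?n]
        A(5-7) R(5) mat_cancel_left[OF A(2)])+
  have lin: "bounded_linear (L k)" for k
    unfolding L_def
    by (intro bounded_linear_sum bounded_linear_mult_right[THEN bounded_linear_compose]
        bounded_linear_of_real[THEN bounded_linear_compose] bounded_linear_vec_nth)
  have mv: "L k (M *v x) = (\<Sum>j<?n. (T' * complex_mat M) $$ (k, j) * complex_of_real (x $ idx j))"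
    if k: "k < ?n" for M :: "real^'m^'m" and k x
  proof -
    have "L k (M *v x) = (\<Sum>l<?n. \<Sum>j<?n. T' $$ (k, l) * (complex_of_real (M $ idx l $ idx j) * complex_of_real (x $ idx j)))"
      unfolding L_def matrix_vector_mult_def
      by (simp add: sum_idx[of "\<lambda>j. _ * _ j", symmetric] sum_distrib_left)
    also have "\<dots> = (\<Sum>j<?n. (\<Sum>l<?n. T' $$ (k, l) * complex_of_real (M $ idx l $ idx j)) * complex_of_real (x $ idx j))"
      by (subst sum.swap) (simp add: sum_distrib_right mult.assoc)
    also have "\<dots> = (\<Sum>j<?n. (T' * complex_mat M) $$ (k, j) * complex_of_real (x $ idx j))"
      by (intro sum.cong refl) (simp add: mult_mat_entry[OF A(7) complex_mat_carrier k] del: index_mult_mat)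
    finally show ?thesis .
  qed
  have eigen: "L k (mop (A - real_part A) \<bullet>\<bullet> x) = \<i> * of_real (\<beta> k) * L k x" if k: "k < ?n" for k x
  proof -
    have entry: "(T' * ?A) $$ (k, j) - (T' * ?R) $$ (k, j) = \<i> * of_real (\<beta> k) * T' $$ (k, j)" if j: "j < ?n" for j
    proof -
      have "(T' * ?A) $$ (k, j) - (T' * ?R) $$ (k, j)
          = (\<Sum>l<?n. (jordan_matrix bs $$ (k, l) - jordan_matrix (re_blocks bs) $$ (k, l)) * T' $$ (l, j))"
        unfolding T'A T'R mult_mat_entry[OF A(5) A(7) k j] mult_mat_entry[OF R(5) A(7) k j]
        by (simp only: sum_subtractf left_diff_distrib)
      also have "\<dots> = (\<Sum>l<?n. if l = k then \<i> * of_real (\<beta> k) * T' $$ (k, j) else 0)"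
      proof (rule sum.cong)
        fix l assume "l \<in> {..<?n}"
        with k bs have kl: "k < sum_list (map fst bs)" "l < sum_list (map fst bs)"
          by auto
        show "(jordan_matrix bs $$ (k, l) - jordan_matrix (re_blocks bs) $$ (k, l)) * T' $$ (l, j)
            = (if l = k then \<i> * of_real (\<beta> k) * T' $$ (k, j) else 0)"
          unfolding jordan_matrix_map_entry[OF kl] \<beta>_def by (auto simp: complex_eq_iff)
      qed simp
      finally show ?thesis
        using k by simp
    qed
    have "L k (mop (A - real_part A) \<bullet>\<bullet> x) = L k (A *v x) - L k (real_part A *v x)"
      by (simp add: matrix_vector_mult_diff_rdistrib bounded_linear.linear[OF lin] linear_diff)
    also have "\<dots> = (\<Sum>j<?n. ((T' * ?A) $$ (k, j) - (T' * ?R) $$ (k, j)) * complex_of_real (x $ idx j))"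
      unfolding mv[OF k] by (simp only: sum_subtractf left_diff_distrib)
    also have "\<dots> = (\<Sum>j<?n. \<i> * of_real (\<beta> k) * T' $$ (k, j) * complex_of_real (x $ idx j))"
      by (intro sum.cong refl) (simp only: entry lessThan_iff)
    finally show ?thesis
      by (simp add: L_def sum_distrib_left mult.assoc)
  qed
  define r where "r = (\<Sum>i<?n. \<Sum>k<?n. norm (T $$ (i, k)))"
  have "norm x \<le> r * (\<Sum>k<?n. norm (L k x))" for x
  proof -
    have comp: "complex_of_real (x $ idx i) = (\<Sum>k<?n. T $$ (i, k) * L k x)" if i: "i < ?n" for i
    proof -
      have "(\<Sum>k<?n. T $$ (i, k) * L k x) = (\<Sum>l<?n. (\<Sum>k<?n. T $$ (i, k) * T' $$ (k, l)) * complex_of_real (x $ idx l))"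
        unfolding L_def sum_distrib_left by (subst sum.swap) (simp add: sum_distrib_right mult.assoc)
      also have "\<dots> = (\<Sum>l<?n. if l = i then complex_of_real (x $ idx i) else 0)"
        using i by (intro sum.cong refl)
          (auto simp: mult_mat_entry[OF A(6,7), symmetric] A(1) simp del: index_mult_mat)
      finally show ?thesis
        using i by simp
    qed
    have "norm x \<le> (\<Sum>i\<in>UNIV. \<bar>x $ i\<bar>)"
      by (rule norm_le_l1_cart)
    also have "\<dots> = (\<Sum>i<?n. norm (\<Sum>k<?n. T $$ (i, k) * L k x))"
      unfolding sum_idx[symmetric] by (intro sum.cong refl) (simp add: comp[symmetric])
    also have "\<dots> \<le> (\<Sum>i<?n. \<Sum>k<?n. norm (T $$ (i, k)) * (\<Sum>k<?n. norm (L k x)))"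
      by (intro sum_mono order.trans[OF norm_sum])
        (auto simp: norm_mult intro!: mult_left_mono member_le_sum)
    finally show ?thesis
      by (simp add: r_def sum_distrib_right)
  qed
  from exp_semisimple_bounded[of ?n L, OF lin eigen this] show ?thesis
    using that by blast
qed

section \<open>The square root of a positive definite matrix\<close>

text \<open>A maximizer x of the quadratic form on the unit sphere of \<open>S\<close> is an
  eigenvector, since otherwise moving x along the residual \<open>v\<close> = f x - \<mu> x would
  exceed the maximum.\<close>

lemma selfadjoint_eigenvector_exists:
  fixes f :: "'a::euclidean_space \<Rightarrow> 'a"
  assumes f: "linear f" and sym: "\<And>x y. f x \<bullet> y = x \<bullet> f y"
    and S: "subspace S" "\<And>x. x \<in> S \<Longrightarrow> f x \<in> S" "S \<noteq> {0}"
  obtains x \<mu> where "x \<in> S" "norm x = 1" "f x = \<mu> *\<^sub>R x"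
proof -
  have cont: "continuous_on A f" for A
    using f by (simp add: linear_continuous_on linear_conv_bounded_linear)
  obtain z where z: "z \<in> S" "z \<noteq> 0"
    using S(3) subspace_0[OF S(1)] by blast
  then have "z /\<^sub>R norm z \<in> S \<inter> sphere 0 1"
    using S(1) by (simp add: subspace_scale)
  then have ne: "S \<inter> sphere 0 1 \<noteq> {}"
    by blast
  have "compact (S \<inter> sphere 0 1)"
    by (intro closed_Int_compact closed_subspace S compact_sphere)
  moreover have "continuous_on (S \<inter> sphere 0 1) (\<lambda>y. f y \<bullet> y)"
    by (intro continuous_on_inner cont continuous_on_id)
  ultimately obtain x where x: "x \<in> S \<inter> sphere 0 1"
      and max: "\<And>y. y \<in> S \<inter> sphere 0 1 \<Longrightarrow> f y \<bullet> y \<le> f x \<bullet> x"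
    using continuous_attains_sup[OF _ ne] by blast
  define \<mu> where "\<mu> = f x \<bullet> x"
  have xx: "x \<bullet> x = 1"
    using x by (simp add: dot_square_norm)
  have le: "f y \<bullet> y \<le> \<mu> * (y \<bullet> y)" if y: "y \<in> S" for y
  proof (cases "y = 0")
    case False
    have "f (y /\<^sub>R norm y) \<bullet> (y /\<^sub>R norm y) \<le> \<mu>"
      unfolding \<mu>_def using False y S(1) by (intro max) (auto simp: subspace_scale)
    then have "(f y \<bullet> y) / (norm y)\<^sup>2 \<le> \<mu>"
      by (simp add: linear_scale[OF f] power2_eq_square field_simps)
    with False show ?thesis
      by (simp add: dot_square_norm field_simps)
  qed (simp add: linear_0[OF f])
  define v where "v = f x - \<mu> *\<^sub>R x"
  define c where "c = f v \<bullet> v - \<mu> * (v \<bullet> v)"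
  have "v \<in> S"
    unfolding v_def using S x by (auto intro!: subspace_diff subspace_scale)
  \<comment> \<open>This is the bound \<open>le\<close> at x + t v, expanded in t; the linear
    coefficient is twice the squared norm of the residual.\<close>
  have ineq: "2 * t * (v \<bullet> v) + t\<^sup>2 * c \<le> 0" for t
  proof -
    have "x + t *\<^sub>R v \<in> S"
      using S x \<open>v \<in> S\<close> by (auto intro!: subspace_add subspace_scale)
    from le[OF this] have "f (x + t *\<^sub>R v) \<bullet> (x + t *\<^sub>R v) - \<mu> * ((x + t *\<^sub>R v) \<bullet> (x + t *\<^sub>R v)) \<le> 0"
      by simp
    also have "f (x + t *\<^sub>R v) \<bullet> (x + t *\<^sub>R v) - \<mu> * ((x + t *\<^sub>R v) \<bullet> (x + t *\<^sub>R v))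
        = 2 * t * (f x \<bullet> v - \<mu> * (x \<bullet> v)) + t\<^sup>2 * c"
      using sym[of v x] xx
      by (simp add: linear_add[OF f] linear_scale[OF f] c_def \<mu>_def inner_commute power2_eq_square algebra_simps)
    also have "f x \<bullet> v - \<mu> * (x \<bullet> v) = v \<bullet> v"
      by (simp add: v_def inner_diff_left)
    finally show ?thesis .
  qed
  have "v \<bullet> v = 0"
  proof (rule ccontr)
    assume "v \<bullet> v \<noteq> 0"
    then have pos: "v \<bullet> v > 0"
      by simp
    \<comment> \<open>So small that the linear term dominates the quadratic one; the added 1 covers
      \<open>c\<close> = 0.\<close>
    define t where "t = (v \<bullet> v) / (\<bar>c\<bar> + 1)"
    have t: "t > 0"
      using pos by (simp add: t_def)
    have "t * \<bar>c\<bar> \<le> v \<bullet> v"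
      using pos by (simp add: t_def field_simps)
    moreover have "t * (- \<bar>c\<bar>) \<le> t * c"
      using t by (intro mult_left_mono) auto
    ultimately have "0 < 2 * (v \<bullet> v) + t * c"
      unfolding mult_minus_right using pos by linarith
    then have "0 < t * (2 * (v \<bullet> v) + t * c)"
      using t by simp
    with ineq[of t] show False
      by (simp add: power2_eq_square algebra_simps)
  qed
  then have "f x = \<mu> *\<^sub>R x"
    by (simp add: v_def)
  moreover have "x \<in> S" "norm x = 1"
    using x by simp_all
  ultimately show ?thesis
    by (intro that)
qed

text \<open>Split off a unit eigenvector x and pass to its orthogonal complement in
  \<open>S\<close>, which f leaves invariant by selfadjointness and which has smaller
  dimension.\<close>

lemma selfadjoint_orthonormal_eigenbasis:
  fixes f :: "'a::euclidean_space \<Rightarrow> 'a"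
  assumes f: "linear f" and sym: "\<And>x y. f x \<bullet> y = x \<bullet> f y"
    and S: "subspace S" "\<And>x. x \<in> S \<Longrightarrow> f x \<in> S"
  shows "\<exists>B ev. finite B \<and> pairwise orthogonal B \<and> (\<forall>b\<in>B. norm b = 1 \<and> f b = ev b *\<^sub>R b) \<and> span B = S"
  using S
proof (induction "dim S" arbitrary: S rule: less_induct)
  case less
  show ?case
  proof (cases "S = {0}")
    case True
    then show ?thesis
      by (intro exI[of _ "{}"]) auto
  next
    case False
    obtain x \<mu> where x: "x \<in> S" "norm x = 1" "f x = \<mu> *\<^sub>R x"
      using selfadjoint_eigenvector_exists[OF f sym less.prems False] by blast
    define S' where "S' = {y \<in> S. x \<bullet> y = 0}"
    have S': "subspace S'"
      using less.prems(1) unfolding S'_def real_vector.subspace_def by (auto simp: inner_add_right)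
    have xx: "x \<bullet> x = 1"
      using x by (simp add: dot_square_norm)
    have "dim S' < dim S"
    proof (rule ccontr)
      assume "\<not> dim S' < dim S"
      then have "S' = S"
        using subspace_dim_equal[OF S' less.prems(1)] unfolding S'_def by auto
      with x xx show False
        unfolding S'_def by force
    qed
    moreover have "f y \<in> S'" if "y \<in> S'" for y
      using that less.prems(2) x sym[of x y] by (auto simp: S'_def)
    ultimately obtain B ev where B: "finite B" "pairwise orthogonal B"
        "\<forall>b\<in>B. norm b = 1 \<and> f b = ev b *\<^sub>R b" "span B = S'"
      using less.hyps[OF _ S'] by blast
    have BS: "B \<subseteq> S'"
      using B(4) span_superset by blast
    then have "x \<notin> B"
      using xx by (auto simp: S'_def)
    have "span (insert x B) = S"
    proof
      show "span (insert x B) \<subseteq> S"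
        using BS x less.prems(1) by (intro span_minimal) (auto simp: S'_def)
      show "S \<subseteq> span (insert x B)"
      proof
        fix y assume "y \<in> S"
        then have "y - (x \<bullet> y) *\<^sub>R x \<in> S'"
          using x xx less.prems(1) by (auto simp: S'_def inner_diff_right subspace_diff subspace_scale)
        then show "y \<in> span (insert x B)"
          using B(4) by (auto simp: span_insert)
      qed
    qed
    moreover have "pairwise orthogonal (insert x B)"
      using B(2) BS by (auto simp: pairwise_insert orthogonal_def S'_def inner_commute)
    ultimately show ?thesis
      using B \<open>x \<notin> B\<close> x
      by (intro exI[of _ "insert x B"] exI[of _ "\<lambda>b. if b = x then \<mu> else ev b"]) auto
  qed
qed

lemma transpose_inner: "(transpose A *v x) \<bullet> y = x \<bullet> (A *v (y :: real^'m))"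
  by (simp add: transpose_matrix_vector dot_lmul_matrix)

lemma symmetric_matrix_inner:
  fixes A :: "real^'m^'m"
  assumes "transpose A = A"
  shows "(A *v x) \<bullet> y = x \<bullet> (A *v y)"
  using transpose_inner[of A x y] assms by simp

lemma symmetric_matrixI:
  fixes A :: "real^'m^'m"
  assumes "\<And>x y. (A *v x) \<bullet> y = x \<bullet> (A *v y)"
  shows "transpose A = A"
proof -
  have "transpose A *v y = A *v y" for y
    by (rule vector_eq_ldot[THEN iffD1])
      (use transpose_inner[of A y] assms[of y] in \<open>simp add: inner_commute\<close>)
  then show ?thesis
    by (simp add: matrix_eq)
qed

lemma symmetric_matrix_eigenbasis:
  fixes A :: "real^'m^'m"
  assumes "transpose A = A"
  obtains B ev where "finite B" "pairwise orthogonal B" "\<And>b. b \<in> B \<Longrightarrow> norm b = 1"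
    "\<And>b. b \<in> B \<Longrightarrow> A *v b = ev b *\<^sub>R b" "span B = UNIV"
  using selfadjoint_orthonormal_eigenbasis[of "(*v) A" UNIV] symmetric_matrix_inner[OF assms]
  by (metis UNIV_I matrix_vector_mul_linear subspace_UNIV)

text \<open>In an orthonormal eigenbasis of \<open>J\<close> the root scales each basis vector by
  the square root of its eigenvalue, which is positive.\<close>

lemma pos_def_sqrt_exists:
  assumes J: "pos_def J"
  shows "\<exists>S. pos_def S \<and> S ** S = J"
proof -
  have J': "transpose J = J" "\<And>x. x \<noteq> 0 \<Longrightarrow> x \<bullet> (J *v x) > 0"
    using J by (auto simp: pos_def_def)
  obtain B ev where B: "finite B" "pairwise orthogonal B" "\<And>b. b \<in> B \<Longrightarrow> norm b = 1"
      "\<And>b. b \<in> B \<Longrightarrow> J *v b = ev b *\<^sub>R b" "span B = UNIV"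
    using symmetric_matrix_eigenbasis[OF J'(1)] by blast
  have bb: "b \<bullet> b = 1" if "b \<in> B" for b
    using B(3)[OF that] by (simp add: dot_square_norm)
  have orth: "b \<bullet> b' = (if b = b' then 1 else 0)" if "b \<in> B" "b' \<in> B" for b b'
    using B(2) bb that by (auto simp: pairwise_def orthogonal_def)
  have pos: "ev b > 0" if "b \<in> B" for b
    using J'(2)[of b] B(3,4)[OF that] bb[OF that] by fastforce
  have expand: "x = (\<Sum>b\<in>B. (b \<bullet> x) *\<^sub>R b)" for x
    using orthonormal_basis_expand[of B x] B by (simp add: inner_commute)
  define g where "g x = (\<Sum>b\<in>B. (sqrt (ev b) * (b \<bullet> x)) *\<^sub>R b)" for x
  have g: "linear g"
    unfolding g_def
    by (intro linearI) (simp_all add: inner_add_right algebra_simps sum.distrib scaleR_sum_right)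
  have gb: "b \<bullet> g x = sqrt (ev b) * (b \<bullet> x)" if "b \<in> B" for b x
    using that B(1) by (simp add: g_def inner_sum_right orth if_distrib cong: if_cong)
  have Jx: "J *v x = (\<Sum>b\<in>B. (ev b * (b \<bullet> x)) *\<^sub>R b)" for x
  proof -
    have "J *v x = (\<Sum>b\<in>B. (b \<bullet> x) *\<^sub>R (J *v b))"
      by (subst expand[of x]) (simp add: linear_sum linear_scale)
    then show ?thesis
      using B(4) by (simp add: mult.commute)
  qed
  have gg: "g (g x) = J *v x" for x
    unfolding Jx g_def[of "g x"] using pos by (intro sum.cong refl) (simp add: gb less_imp_le)
  have S: "matrix g *v x = g x" for x
    using g by simp
  have "matrix g ** matrix g = J"
    by (simp add: matrix_eq matrix_vector_mul_assoc[symmetric] S gg)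
  moreover have "transpose (matrix g) = matrix g"
    by (rule symmetric_matrixI) (simp only: S, simp add: g_def inner_sum_right inner_sum_left inner_commute mult_ac)
  moreover have "x \<bullet> (matrix g *v x) > 0" if "x \<noteq> 0" for x
  proof -
    have eq: "x \<bullet> g x = (\<Sum>b\<in>B. sqrt (ev b) * (b \<bullet> x)\<^sup>2)"
      by (simp add: g_def inner_sum_right inner_commute power2_eq_square mult_ac)
    obtain b where "b \<in> B" "b \<bullet> x \<noteq> 0"
      using expand[of x] \<open>x \<noteq> 0\<close> by (metis (no_types, lifting) scale_zero_left sum.neutral)
    then have "(\<Sum>b\<in>B. sqrt (ev b) * (b \<bullet> x)\<^sup>2) > 0"
      using B(1) pos by (intro sum_pos2[of _ b]) (auto simp: less_imp_le)
    then show ?thesis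
      by (simp add: S eq)
  qed
  ultimately show ?thesis
    unfolding pos_def_def by blast
qed

text \<open>With d = S - S' and P = S + S', equality of the squares gives d P + P d = 0. Testing
  this with an eigenvector b of the symmetric d yields 2 ev(b) (b . P b) = 0, and P is positive
  definite, so every eigenvalue of d is zero.\<close>

lemma pos_def_sqrt_unique:
  assumes "pos_def S" "pos_def S'" "S ** S = S' ** S'"
  shows "S = (S' :: real^'m^'m)"
proof -
  let ?d = "S - S'" and ?P = "S + S'"
  have sym: "transpose S = S" "transpose S' = S'"
    using assms by (auto simp: pos_def_def)
  have d: "transpose ?d = ?d"
    using sym by (simp add: transpose_def vec_eq_iff)
  have P: "x \<bullet> (?P *v x) > 0" if "x \<noteq> 0" for x
    using assms that by (simp add: pos_def_def matrix_vector_mult_add_rdistrib inner_add_right add_pos_pos)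
  have eq: "?d *v (?P *v x) + ?P *v (?d *v x) = 0" for x
    using arg_cong[OF assms(3), of "\<lambda>M. M *v x"]
    by (simp add: matrix_vector_mult_add_rdistrib matrix_vector_mult_diff_rdistrib
        matrix_vector_right_distrib matrix_vector_mult_diff_distrib matrix_vector_mul_assoc[symmetric])
  obtain B ev where B: "\<And>b. b \<in> B \<Longrightarrow> norm b = 1" "\<And>b. b \<in> B \<Longrightarrow> ?d *v b = ev b *\<^sub>R b" "span B = UNIV"
    using symmetric_matrix_eigenbasis[OF d] by metis
  have "?d *v b = 0" if b: "b \<in> B" for b
  proof -
    have "0 = b \<bullet> (?d *v (?P *v b)) + b \<bullet> (?P *v (?d *v b))"
      using eq[of b] by (metis inner_add_right inner_zero_right)
    also have "b \<bullet> (?d *v (?P *v b)) = ev b * (b \<bullet> (?P *v b))"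
      using symmetric_matrix_inner[OF d, of b "?P *v b"] B(2)[OF b] by simp
    also have "b \<bullet> (?P *v (?d *v b)) = ev b * (b \<bullet> (?P *v b))"
      using B(2)[OF b] by (simp add: linear_scale)
    finally have "ev b * (b \<bullet> (?P *v b)) = 0"
      by simp
    moreover have "b \<noteq> 0"
      using B(1)[OF b] by auto
    ultimately have "ev b = 0"
      using P[of b] by simp
    then show ?thesis
      using B(2)[OF b] by simp
  qed
  then have "?d *v x = 0" for x
    using linear_eq_0_on_span[OF matrix_vector_mul_linear[of ?d], of B x] B(3) by auto
  then have "?d = 0"
    by (simp add: matrix_eq)
  then show ?thesis
    by simp
qed

lemma pos_def_sqrt_works:
  assumes "pos_def J"
  shows "pos_def (pos_def_sqrt J)" "pos_def_sqrt J ** pos_def_sqrt J = J"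
proof -
  obtain S where S: "pos_def S" "S ** S = J"
    using pos_def_sqrt_exists[OF assms] by blast
  have "S' = S" if S': "pos_def S' \<and> S' ** S' = J" for S'
    by (rule pos_def_sqrt_unique[OF conjunct1[OF S'] S(1)]) (simp only: S S')
  then have "pos_def_sqrt J = S"
    unfolding pos_def_sqrt_def using S by (intro the_equality conjI)
  then show "pos_def (pos_def_sqrt J)" "pos_def_sqrt J ** pos_def_sqrt J = J"
    by (simp_all only: S)
qed

lemma pos_def_invertible:
  fixes S :: "real^'m^'m"
  assumes "pos_def S"
  shows "invertible S"
proof -
  have "x = 0" if "S *v x = 0" for x
  proof (rule ccontr)
    assume "x \<noteq> 0"
    then have "x \<bullet> (S *v x) > 0"
      using assms unfolding pos_def_def by blast
    with that show False
      by simp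
  qed
  then show ?thesis
    unfolding invertible_left_inverse matrix_left_invertible_ker by blast
qed

lemma matrix_inv_inverse:
  assumes "invertible A"
  shows "A ** matrix_inv A = mat 1" "matrix_inv A ** A = mat 1"
proof -
  have "A ** matrix_inv A = mat 1 \<and> matrix_inv A ** A = mat 1"
    unfolding matrix_inv_def by (rule someI_ex) (use assms in \<open>simp only: invertible_def\<close>)
  then show "A ** matrix_inv A = mat 1" "matrix_inv A ** A = mat 1"
    by blast+
qed

lemma inv_sqrt_inverse:
  assumes "pos_def J"
  shows "pos_def_sqrt J ** inv_sqrt J = mat 1" "inv_sqrt J ** pos_def_sqrt J = mat 1"
  using matrix_inv_inverse[OF pos_def_invertible[OF pos_def_sqrt_works(1)[OF assms]]]
  unfolding inv_sqrt_def by simp_all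

section \<open>Intertwining exponentials\<close>

text \<open>Among the first DIM + 1 iterates one lies in the span of its predecessors. This span is
  then invariant under \<open>T\<close> and contains every iterate, while \<open>N\<close> vanishes
  on its generators. The lemma extends the finitely many commutator conditions to all n.\<close>

lemma linear_funpow_eq_0:
  fixes T :: "'a::euclidean_space \<Rightarrow> 'a" and N :: "'a \<Rightarrow> 'b::real_vector"
  assumes T: "linear T" and N: "linear N" and zero: "\<And>n. n < DIM('a) \<Longrightarrow> N ((T ^^ n) x) = 0"
  shows "N ((T ^^ n) x) = 0"
proof -
  let ?Y = "\<lambda>n. (T ^^ n) x"
  let ?S = "\<lambda>k. span (?Y ` {..<k})"
  have "\<exists>k\<le>DIM('a). ?Y k \<in> ?S k"
  proof (rule ccontr)
    assume "\<not> (\<exists>k\<le>DIM('a). ?Y k \<in> ?S k)"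
    then have notin: "?Y k \<notin> ?S k" if "k \<le> DIM('a)" for k
      using that by simp
    have "k \<le> Suc DIM('a) \<Longrightarrow> independent (?Y ` {..<k}) \<and> card (?Y ` {..<k}) = k" for k
    proof (induction k)
      case 0
      then show ?case
        by (simp add: independent_empty)
    next
      case (Suc k)
      then have IH: "independent (?Y ` {..<k})" "card (?Y ` {..<k}) = k" and n: "?Y k \<notin> ?S k"
        using notin[of k] by auto
      have "?Y k \<notin> ?Y ` {..<k}"
        using n span_base[of "?Y k" "?Y ` {..<k}"] by blast
      then show ?case
        using IH independent_insertI[OF n IH(1)] by (simp add: lessThan_Suc)
    qed
    from this[of "Suc DIM('a)"] show False
      using independent_bound[of "?Y ` {..<Suc DIM('a)}"] by simp
  qed
  then obtain k where k: "k \<le> DIM('a)" "?Y k \<in> ?S k"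
    by blast
  have "T y \<in> ?S k" if y: "y \<in> ?S k" for y
  proof -
    have "T ` ?Y ` {..<k} \<subseteq> ?S k"
    proof clarify
      fix i assume "i < k"
      then have "Suc i < k \<or> Suc i = k"
        by auto
      then have "?Y (Suc i) \<in> ?S k"
        using k(2) span_base[of "?Y (Suc i)" "?Y ` {..<k}"] by blast
      then show "T (?Y i) \<in> ?S k"
        by simp
    qed
    then have "span (T ` ?Y ` {..<k}) \<subseteq> ?S k"
      by (rule span_minimal) (rule subspace_span)
    then show ?thesis
      using y linear_span_image[OF T, of "?Y ` {..<k}"] by blast
  qed
  moreover have "x \<in> ?S k"
  \<comment> \<open>For \<open>k\<close> = 0 the span is that of the empty set, and the choice of
    \<open>k\<close> already places x in it.\<close>
  proof (cases "k = 0")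
    case False
    then have "?Y 0 \<in> ?Y ` {..<k}"
      by blast
    then show ?thesis
      using span_base[of "?Y 0" "?Y ` {..<k}"] by simp
  qed (use k in simp)
  ultimately have "?Y n \<in> ?S k"
    by (induction n) auto
  then show ?thesis
    by (rule linear_eq_0_on_span[OF N, rotated]) (use zero k(1) in auto)
qed

text \<open>Powers of left multiplication by \<open>u\<close> are left multiplications by powers of
  \<open>u\<close>. This and its mirror image below evaluate the exponential of a sum of a left and
  a right multiplication.\<close>

lemma exp_mult_left_app:
  fixes u x :: "'a::{real_normed_algebra_1, banach}"
  shows "exp (endo_of ((*) u)) \<bullet>\<bullet> x = exp u * x"
proof -
  have "endo_of ((*) u) ^ n \<bullet>\<bullet> x = u ^ n * x" for n
    by (induction n) (simp_all add: bounded_linear_mult_right mult.assoc)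
  then have eq: "(\<lambda>n. (endo_of ((*) u) ^ n /\<^sub>R fact n) \<bullet>\<bullet> x) = (\<lambda>n. (u ^ n /\<^sub>R fact n) * x)"
    by (simp add: app.scaleR_left)
  have "(\<lambda>n. (endo_of ((*) u) ^ n /\<^sub>R fact n) \<bullet>\<bullet> x) sums (exp (endo_of ((*) u)) \<bullet>\<bullet> x)"
    by (rule bounded_linear.sums[OF app.bounded_linear_left exp_converges])
  moreover have "(\<lambda>n. (u ^ n /\<^sub>R fact n) * x) sums (exp u * x)"
    by (intro sums_mult2 exp_converges)
  ultimately show ?thesis
    unfolding eq by (rule sums_unique2)
qed

lemma exp_mult_right_app:
  fixes u x :: "'a::{real_normed_algebra_1, banach}"
  shows "exp (endo_of (\<lambda>x. x * u)) \<bullet>\<bullet> x = x * exp u"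
proof -
  have "endo_of (\<lambda>x. x * u) ^ n \<bullet>\<bullet> x = x * u ^ n" for n
    by (induction n) (simp_all add: bounded_linear_mult_left mult.assoc power_commutes)
  then have eq: "(\<lambda>n. (endo_of (\<lambda>x. x * u) ^ n /\<^sub>R fact n) \<bullet>\<bullet> x) = (\<lambda>n. x * (u ^ n /\<^sub>R fact n))"
    by (simp add: app.scaleR_left)
  have "(\<lambda>n. (endo_of (\<lambda>x. x * u) ^ n /\<^sub>R fact n) \<bullet>\<bullet> x) sums (exp (endo_of (\<lambda>x. x * u)) \<bullet>\<bullet> x)"
    by (rule bounded_linear.sums[OF app.bounded_linear_left exp_converges])
  moreover have "(\<lambda>n. x * (u ^ n /\<^sub>R fact n)) sums (x * exp u)"
    by (intro sums_mult exp_converges)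
  ultimately show ?thesis
    unfolding eq by (rule sums_unique2)
qed

text \<open>
  The map \<open>x \<mapsto> x a - u x\<close> leaves the centralizer of all \<open>Y n\<close> invariant, and its exponential
  sends \<open>1\<close> to \<open>exp (- u) exp a\<close>.
\<close>

lemma exp_mult_exp_commute:
  fixes a u :: "'a::{real_normed_algebra_1, banach}"
  assumes Y: "\<And>n. Y (Suc n) = Y n * a - a * Y n" and u: "\<And>n. Y n * (u - a) = (u - a) * Y n"
  shows "exp (- u) * exp a * Y n = Y n * (exp (- u) * exp a)"
proof -
  let ?L = "endo_of ((*) (- u))" and ?R = "endo_of (\<lambda>x. x * a)"
  define S where "S = (\<Inter>n. {x. x * Y n = Y n * x})"
  have "subspace S"
    by (auto simp: S_def real_vector.subspace_def distrib_left distrib_right)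
  moreover have "closed S"
    unfolding S_def by (intro closed_INT ballI closed_Collect_eq continuous_intros)
  moreover have "(?L + ?R) \<bullet>\<bullet> x \<in> S" if x: "x \<in> S" for x
  proof -
    have x: "x * Y n = Y n * x" for n
      using x by (auto simp: S_def)
    \<comment> \<open>Since u - a commutes with every \<open>Y n\<close>, the commutators of
      \<open>Y n\<close> with u and with a are the same element \<open>Y (Suc n)\<close>.\<close>
    have aY: "a * Y n = Y n * a - Y (Suc n)" for n
      by (simp add: Y)
    have uY: "u * Y n = Y n * u - Y (Suc n)" for n
      using u[of n] by (simp add: Y algebra_simps)
    have "(x * a - u * x) * Y n = Y n * (x * a - u * x)" for n
    proof -
      have "(x * a - u * x) * Y n = x * (a * Y n) - u * (x * Y n)"
        by (simp add: algebra_simps)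
      also have "\<dots> = x * (a * Y n) - (u * Y n) * x"
        by (simp add: x mult.assoc)
      \<comment> \<open>The two terms with \<open>Y (Suc n)\<close> cancel in the next step because
        x commutes with that element too; hence the centralizer of the whole sequence.\<close>
      also have "\<dots> = (x * Y n) * a - x * Y (Suc n) - Y n * u * x + Y (Suc n) * x"
        unfolding aY uY by (simp add: algebra_simps)
      also have "\<dots> = Y n * (x * a - u * x)"
        unfolding x by (simp add: algebra_simps)
      finally show ?thesis .
    qed
    then show ?thesis
      by (simp add: S_def app.add_left bounded_linear_mult_left bounded_linear_mult_right)
  qed
  moreover have "1 \<in> S"
    by (simp add: S_def)
  ultimately have "exp (?L + ?R) \<bullet>\<bullet> 1 \<in> S"
    by (rule exp_app_subspace)
  \<comment> \<open>Left and right multiplications commute by associativity, so the exponential of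
    their sum factors.\<close>
  moreover have "?L * ?R = ?R * ?L"
    by (rule endo_eqI) (simp add: bounded_linear_mult_left bounded_linear_mult_right mult.assoc)
  then have "exp (?L + ?R) \<bullet>\<bullet> 1 = exp (- u) * exp a"
    by (simp add: exp_add_commuting exp_mult_left_app exp_mult_right_app)
  ultimately show ?thesis
    by (simp add: S_def)
qed

lemma iter_commutator_replicate:
  "iter_commutator Z (replicate n A @ [M]) = commutator (((\<lambda>X. commutator X A) ^^ n) Z) M"
proof -
  have "foldl commutator Z (replicate n A) = ((\<lambda>X. commutator X A) ^^ n) Z"
    by (induction n arbitrary: Z) (simp_all add: funpow_swap1 del: funpow.simps(2) add: funpow_Suc_right)
  then show ?thesis
    by (simp add: iter_commutator_def)
qed

lemma mop_commutator: "mop (commutator X Y) = mop X * mop Y - mop Y * mop X"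
  by (simp add: commutator_def mop_diff mop_mult)

lemma mop_inj: "mop A = mop B \<Longrightarrow> A = B"
  unfolding matrix_eq by (metis app_mop)

lemma linear_commutator: "linear (\<lambda>X. commutator X M)"
  by (intro linearI mop_inj)
    (simp_all add: mop_commutator mop_add mop_scaleR algebra_simps)

text \<open>
  In the application \<open>a\<close> and \<open>v\<close> are the halves of \<open>A\<close> and \<open>V\<close>, and \<open>c\<close> is \<open>C\<inverse>\<close>.
\<close>

definition conj_exp :: "'a::{real_normed_algebra_1, banach} \<Rightarrow> 'a \<Rightarrow> 'a \<Rightarrow> real \<Rightarrow> 'a" where
  "conj_exp v c a t = exp (- (t *\<^sub>R v)) * c * exp (t *\<^sub>R a)"

text \<open>The time derivative of \<open>conj_exp\<close>, expressed through
  \<open>conj_exp\<close> itself so that bounds on the latter carry over.\<close>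

definition conj_exp' :: "'a::{real_normed_algebra_1, banach} \<Rightarrow> 'a \<Rightarrow> 'a \<Rightarrow> real \<Rightarrow> 'a" where
  "conj_exp' v c a t = conj_exp v c a t * a - v * conj_exp v c a t"

lemma conj_exp_has_derivative:
  "(conj_exp v c a has_vector_derivative conj_exp' v c a t) (at t within T)"
proof -
  have "((\<lambda>t. exp (t *\<^sub>R (- v)) * c) has_vector_derivative (- v) * exp (t *\<^sub>R (- v)) * c) (at t)"
    using bounded_linear.has_vector_derivative[OF bounded_linear_mult_left[of c]
        exp_scaleR_has_vector_derivative_left[of "- v" t]] by simp
  from has_vector_derivative_mult[OF has_vector_derivative_at_within[OF this] exp_scaleR_has_vector_derivative_right[of a]]
  show ?thesis
    unfolding conj_exp_def[abs_def] conj_exp'_def by (simp add: algebra_simps)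
qed

lemma conj_exp'_has_derivative:
  "(conj_exp' v c a has_vector_derivative conj_exp' v c a t * a - v * conj_exp' v c a t) (at t within T)"
proof -
  have "conj_exp' v c a = (\<lambda>t. conj_exp v c a t * a - v * conj_exp v c a t)"
    by (simp add: fun_eq_iff conj_exp'_def)
  then show ?thesis
    using has_vector_derivative_diff[OF
        bounded_linear.has_vector_derivative[OF bounded_linear_mult_left[of a] conj_exp_has_derivative[of v c a t T]]
        bounded_linear.has_vector_derivative[OF bounded_linear_mult_right[of v] conj_exp_has_derivative[of v c a t T]]]
    by simp
qed

text \<open>Write Phi for \<open>conj_exp v c a t\<close>. From Phi' = Phi a - v Phi the
  coefficients of x' match, and Phi'' + 2 v Phi' = Phi a^2 - v^2 Phi. By \<open>inter\<close> the
  latter is Phi b - w Phi, which matches the coefficients of x.\<close>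

lemma second_order_transfer:
  fixes a b v w c :: "'a::{banach, perfect_space} endo"
  assumes inter: "\<And>t. conj_exp v c a t * (b - a * a) = (w - v * v) * conj_exp v c a t"
    and x: "(x has_vector_derivative p t) (at t within T)"
    and p: "(p has_vector_derivative - ((a + a) \<bullet>\<bullet> p t + b \<bullet>\<bullet> x t)) (at t within T)"
  defines "y \<equiv> \<lambda>t. conj_exp v c a t \<bullet>\<bullet> x t"
    and "q \<equiv> \<lambda>t. conj_exp' v c a t \<bullet>\<bullet> x t + conj_exp v c a t \<bullet>\<bullet> p t"
  shows "(y has_vector_derivative q t) (at t within T)"
    and "(q has_vector_derivative - ((v + v) \<bullet>\<bullet> q t + w \<bullet>\<bullet> y t)) (at t within T)"
proof -
  let ?\<Phi> = "conj_exp v c a t" and ?\<Psi> = "conj_exp' v c a t"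
  let ?p' = "- ((a + a) \<bullet>\<bullet> p t + b \<bullet>\<bullet> x t)"
  show "(y has_vector_derivative q t) (at t within T)"
    using app.has_vector_derivative[OF conj_exp_has_derivative x, of v c a]
    unfolding y_def q_def by (simp add: add.commute)
  have q: "(q has_vector_derivative
      (?\<Psi> \<bullet>\<bullet> p t + (?\<Psi> * a - v * ?\<Psi>) \<bullet>\<bullet> x t) + (?\<Phi> \<bullet>\<bullet> ?p' + ?\<Psi> \<bullet>\<bullet> p t)) (at t within T)"
    unfolding q_def
    by (intro has_vector_derivative_add app.has_vector_derivative conj_exp_has_derivative
        conj_exp'_has_derivative x p)
  have "(?\<Psi> * a - v * ?\<Psi>) + (v + v) * ?\<Psi> = ?\<Phi> * b - w * ?\<Phi>"
    using inter[of t] by (simp add: conj_exp'_def algebra_simps)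
  then have 1: "?\<Psi> * a - v * ?\<Psi> = ?\<Phi> * b - w * ?\<Phi> - (v + v) * ?\<Psi>"
    by (simp add: algebra_simps)
  have 2: "?\<Psi> + ?\<Psi> = ?\<Phi> * (a + a) - (v + v) * ?\<Phi>"
    by (simp add: conj_exp'_def algebra_simps)
  have "(?\<Psi> \<bullet>\<bullet> p t + (?\<Psi> * a - v * ?\<Psi>) \<bullet>\<bullet> x t) + (?\<Phi> \<bullet>\<bullet> ?p' + ?\<Psi> \<bullet>\<bullet> p t)
      = (?\<Psi> + ?\<Psi>) \<bullet>\<bullet> p t + (?\<Psi> * a - v * ?\<Psi>) \<bullet>\<bullet> x t - (?\<Phi> * (a + a)) \<bullet>\<bullet> p t - (?\<Phi> * b) \<bullet>\<bullet> x t"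
    by (simp add: app.add_left app.add_right app.minus_right app.diff_right)
  also have "\<dots> = - ((v + v) \<bullet>\<bullet> q t + w \<bullet>\<bullet> y t)"
    unfolding 1 2 q_def y_def by (simp add: app.add_left app.add_right app.diff_left)
  finally show "(q has_vector_derivative - ((v + v) \<bullet>\<bullet> q t + w \<bullet>\<bullet> y t)) (at t within T)"
    using q by simp
qed

text \<open>By commutation each exponential splits into a real-part factor and a remainder. The
  real-part factors can be placed next to \<open>c\<close> on either side, and moving one of them
  past \<open>c\<close> turns it into the inverse of the other.\<close>

lemma conj_exp_real_part:
  fixes vr ar c :: "'a::{real_normed_algebra_1, banach}"
  assumes "vr * v = v * vr" "ar * a = a * ar" and "c * ar = vr * c"
  shows "conj_exp v c a t = conj_exp (v - vr) c (a - ar) t"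
proof -
  let ?vr = "- (t *\<^sub>R vr)" and ?v = "- (t *\<^sub>R (v - vr))"
  let ?ar = "t *\<^sub>R ar" and ?a = "t *\<^sub>R (a - ar)"
  have "?v * ?vr = ?vr * ?v" "?ar * ?a = ?a * ?ar"
    using assms(1,2) by (simp_all add: algebra_simps)
  then have "exp (?v + ?vr) = exp ?v * exp ?vr" "exp (?ar + ?a) = exp ?ar * exp ?a"
    by (simp_all only: exp_add_commuting)
  moreover have "- (t *\<^sub>R v) = ?v + ?vr" "t *\<^sub>R a = ?ar + ?a"
    by (simp_all add: algebra_simps)
  ultimately have "conj_exp v c a t = exp ?v * (exp ?vr * c) * exp ?ar * exp ?a"
    by (simp only: conj_exp_def mult.assoc)
  also have "exp ?vr * c = c * exp (- ?ar)"
    using assms(3) by (intro exp_intertwine) simp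
  also have "exp ?v * (c * exp (- ?ar)) * exp ?ar * exp ?a = exp ?v * c * (exp (- ?ar) * exp ?ar) * exp ?a"
    by (simp only: mult.assoc)
  also have "\<dots> = conj_exp (v - vr) c (a - ar) t"
    by (simp only: exp_neg_cancel mult_1_right conj_exp_def)
  finally show ?thesis .
qed

text \<open>Exchanging \<open>a\<close> with \<open>v\<close> and \<open>c\<close> with
  \<open>c'\<close> makes the exponentials cancel from the middle outwards. The inverse thus has the
  same form, and bounds for \<open>conj_exp\<close> apply to it as well.\<close>

lemma conj_exp_inverse:
  assumes "c' * c = 1"
  shows "conj_exp a c' v t * conj_exp v c a t = 1"
proof -
  have "conj_exp a c' v t * conj_exp v c a t
      = exp (- (t *\<^sub>R a)) * (c' * ((exp (t *\<^sub>R v) * exp (- (t *\<^sub>R v))) * c)) * exp (t *\<^sub>R a)"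
    by (simp only: conj_exp_def mult.assoc)
  also have "\<dots> = 1"
    by (simp only: exp_neg_cancel mult_1_left mult_1_right assms)
  finally show ?thesis .
qed

lemma conj_exp_bounded:
  fixes v c a :: "'a::{banach, perfect_space} endo"
  assumes a: "\<And>t x. norm (exp (t *\<^sub>R a) \<bullet>\<bullet> x) \<le> ca * norm x"
    and v: "\<And>t x. norm (exp (t *\<^sub>R v) \<bullet>\<bullet> x) \<le> cv * norm x"
  shows "norm (conj_exp v c a t \<bullet>\<bullet> x) \<le> \<bar>cv\<bar> * norm c * \<bar>ca\<bar> * norm x"
proof -
  have "norm (conj_exp v c a t \<bullet>\<bullet> x) \<le> cv * norm (c \<bullet>\<bullet> exp (t *\<^sub>R a) \<bullet>\<bullet> x)"
    using v[of "- t" "c \<bullet>\<bullet> exp (t *\<^sub>R a) \<bullet>\<bullet> x"] by (simp add: conj_exp_def)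
  also have "\<dots> \<le> \<bar>cv\<bar> * (norm c * (\<bar>ca\<bar> * norm x))"
  proof (intro mult_mono)
    have "norm (exp (t *\<^sub>R a) \<bullet>\<bullet> x) \<le> \<bar>ca\<bar> * norm x"
      using a[of t x] by (rule order.trans) (intro mult_right_mono, auto)
    then show "norm (c \<bullet>\<bullet> exp (t *\<^sub>R a) \<bullet>\<bullet> x) \<le> norm c * (\<bar>ca\<bar> * norm x)"
      using norm_app[of c "exp (t *\<^sub>R a) \<bullet>\<bullet> x"] mult_left_mono[of _ _ "norm c"] by (meson norm_ge_zero order.trans)
  qed auto
  finally show ?thesis
    by (simp only: mult.assoc)
qed

text \<open>The map of phase space from (x, x') to (y, y') induced at time t by y = Phi x, where Phi
  is \<open>conj_exp v c a\<close>.\<close>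

definition conj_transfer ::
    "'a::{banach, perfect_space} endo \<Rightarrow> 'a endo \<Rightarrow> 'a endo \<Rightarrow> real \<Rightarrow> 'a \<times> 'a \<Rightarrow> 'a \<times> 'a" where
  "conj_transfer v c a t z =
     (conj_exp v c a t \<bullet>\<bullet> fst z, conj_exp' v c a t \<bullet>\<bullet> fst z + conj_exp v c a t \<bullet>\<bullet> snd z)"

text \<open>The off-diagonal block of the composition is the formal derivative of the product of the
  two conjugating factors. That product is 1, so the block reduces to 1 a - a 1 = 0.\<close>

lemma conj_transfer_inverse:
  assumes "c' * c = 1"
  shows "conj_transfer a c' v t (conj_transfer v c a t z) = z"
proof -
  let ?\<Phi> = "conj_exp v c a t" and ?\<Phi>' = "conj_exp a c' v t"
  have inv: "?\<Phi>' * ?\<Phi> = 1"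
    by (rule conj_exp_inverse[OF assms])
  have "conj_exp' a c' v t * ?\<Phi> + ?\<Phi>' * conj_exp' v c a t = (?\<Phi>' * ?\<Phi>) * a - a * (?\<Phi>' * ?\<Phi>)"
    by (simp add: conj_exp'_def algebra_simps)
  also have "\<dots> = 0"
    by (simp add: inv)
  finally have "conj_exp' a c' v t \<bullet>\<bullet> ?\<Phi> \<bullet>\<bullet> fst z + ?\<Phi>' \<bullet>\<bullet> conj_exp' v c a t \<bullet>\<bullet> fst z = 0"
    unfolding app_times[symmetric] app.add_left[symmetric] by (simp only: app.zero_left)
  moreover have "?\<Phi>' \<bullet>\<bullet> ?\<Phi> \<bullet>\<bullet> x = x" for x
    unfolding app_times[symmetric] inv by simp
  ultimately show ?thesis
    by (simp add: conj_transfer_def app.add_right add.assoc[symmetric])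
qed

text \<open>\<open>conj_exp'\<close> combines \<open>conj_exp\<close> with the fixed operators
  \<open>a\<close> and \<open>v\<close>, so a bound uniform in t for \<open>conj_exp\<close> is
  enough.\<close>

lemma conj_transfer_bounded:
  fixes v c a :: "'a::{banach, perfect_space} endo"
  assumes "\<And>t x. norm (conj_exp v c a t \<bullet>\<bullet> x) \<le> r * norm x"
  obtains R where "R > 0" "\<And>t z. norm (conj_transfer v c a t z) \<le> R * norm z"
proof -
  \<comment> \<open>The first and third summands bound the two occurrences of
    \<open>conj_exp\<close>, the parenthesis bounds \<open>conj_exp'\<close>, and the 1 makes the
    constant positive.\<close>
  let ?R = "\<bar>r\<bar> + (\<bar>r\<bar> * norm a + norm v * \<bar>r\<bar>) + \<bar>r\<bar> + 1"
  have b: "norm (conj_exp v c a t \<bullet>\<bullet> x) \<le> \<bar>r\<bar> * norm x" for t x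
    using assms[of t x] by (rule order.trans) (intro mult_right_mono, auto)
  have "norm (conj_transfer v c a t z) \<le> ?R * norm z" for t z
  proof -
    let ?\<Phi> = "conj_exp v c a t"
    have f: "norm (fst z) \<le> norm z" and s: "norm (snd z) \<le> norm z"
      using norm_fst_le[of "fst z" "snd z"] norm_snd_le[of "snd z" "fst z"] by simp_all
    have 1: "norm (?\<Phi> \<bullet>\<bullet> fst z) \<le> \<bar>r\<bar> * norm z"
      using b[of t "fst z"] by (rule order.trans) (intro mult_left_mono f, simp)
    have 2: "norm (?\<Phi> \<bullet>\<bullet> snd z) \<le> \<bar>r\<bar> * norm z"
      using b[of t "snd z"] by (rule order.trans) (intro mult_left_mono s, simp)
    have "norm (?\<Phi> \<bullet>\<bullet> a \<bullet>\<bullet> fst z) \<le> \<bar>r\<bar> * norm (a \<bullet>\<bullet> fst z)"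
      by (rule b)
    also have "\<dots> \<le> \<bar>r\<bar> * (norm a * norm z)"
      using norm_app[of a "fst z"] mult_left_mono[OF f, of "norm a"] by (intro mult_left_mono) auto
    finally have 3: "norm (?\<Phi> \<bullet>\<bullet> a \<bullet>\<bullet> fst z) \<le> \<bar>r\<bar> * norm a * norm z"
      by (simp add: mult.assoc)
    have "norm (v \<bullet>\<bullet> ?\<Phi> \<bullet>\<bullet> fst z) \<le> norm v * norm (?\<Phi> \<bullet>\<bullet> fst z)"
      by (rule norm_app)
    also have "\<dots> \<le> norm v * (\<bar>r\<bar> * norm z)"
      by (intro mult_left_mono 1) simp
    finally have 4: "norm (v \<bullet>\<bullet> ?\<Phi> \<bullet>\<bullet> fst z) \<le> norm v * \<bar>r\<bar> * norm z"
      by (simp add: mult.assoc)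
    have "norm (conj_transfer v c a t z) \<le> norm (?\<Phi> \<bullet>\<bullet> fst z)
        + norm (conj_exp' v c a t \<bullet>\<bullet> fst z + ?\<Phi> \<bullet>\<bullet> snd z)"
      unfolding conj_transfer_def by (rule norm_Pair_le)
    also have "\<dots> \<le> norm (?\<Phi> \<bullet>\<bullet> fst z)
        + (norm (conj_exp' v c a t \<bullet>\<bullet> fst z) + norm (?\<Phi> \<bullet>\<bullet> snd z))"
      by (intro add_left_mono norm_triangle_ineq)
    also have "norm (conj_exp' v c a t \<bullet>\<bullet> fst z) \<le> norm (?\<Phi> \<bullet>\<bullet> a \<bullet>\<bullet> fst z) + norm (v \<bullet>\<bullet> ?\<Phi> \<bullet>\<bullet> fst z)"
      by (simp add: conj_exp'_def app.diff_left norm_triangle_ineq4)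
    finally show ?thesis
      using 1 2 3 4 norm_ge_zero[of z] unfolding distrib_right by linarith
  qed
  moreover have "?R > 0"
    by (intro add_nonneg_pos add_nonneg_nonneg mult_nonneg_nonneg) auto
  ultimately show ?thesis
    by (rule that[rotated])
qed

section \<open>A strict Lyapunov function\<close>

text \<open>Twice the usual energy of y'' + V y' + W y = 0, plus a cross term through which the
  derivative also becomes negative in y.\<close>

definition lyapunov :: "real \<Rightarrow> real^'m^'m \<Rightarrow> (real^'m) \<times> (real^'m) \<Rightarrow> real" where
  "lyapunov \<epsilon> W z = snd z \<bullet> snd z + fst z \<bullet> (W *v fst z) + 2 * \<epsilon> * (snd z \<bullet> (W *v fst z))"

text \<open>The derivative of \<open>lyapunov\<close> along solutions for symmetric
  \<open>W\<close>; the symmetry cancels the mixed terms of the energy part.\<close>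

definition lyapunov' :: "real \<Rightarrow> real^'m^'m \<Rightarrow> real^'m^'m \<Rightarrow> (real^'m) \<times> (real^'m) \<Rightarrow> real" where
  "lyapunov' \<epsilon> V W z = - (snd z \<bullet> ((V + transpose V) *v snd z))
     + 2 * \<epsilon> * (snd z \<bullet> (W *v snd z) - (V *v snd z) \<bullet> (W *v fst z) - (W *v fst z) \<bullet> (W *v fst z))"

text \<open>The quadratic form has a positive minimum on the compact unit sphere, and homogeneity
  extends the bound to all vectors.\<close>

lemma pos_def_lower_bound:
  fixes S :: "real^'m^'m"
  assumes "pos_def S"
  obtains d where "d > 0" "\<And>x. d * (x \<bullet> x) \<le> x \<bullet> (S *v x)"
proof -
  have cont: "continuous_on (sphere 0 1) (\<lambda>x. x \<bullet> (S *v x))"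
    by (intro continuous_on_inner continuous_on_id linear_continuous_on matrix_vector_mul_bounded_linear)
  have "sphere (0 :: real^'m) 1 \<noteq> {}"
    by simp
  then obtain x where x: "x \<in> sphere 0 1" and min: "\<And>y. y \<in> sphere 0 1 \<Longrightarrow> x \<bullet> (S *v x) \<le> y \<bullet> (S *v y)"
    using continuous_attains_inf[OF compact_sphere _ cont] by blast
  have "x \<noteq> 0"
    using x by auto
  then have pos: "x \<bullet> (S *v x) > 0"
    using assms by (simp add: pos_def_def)
  have "x \<bullet> (S *v x) * (y \<bullet> y) \<le> y \<bullet> (S *v y)" for y
  proof (cases "y = 0")
    case False
    then have "x \<bullet> (S *v x) \<le> (y /\<^sub>R norm y) \<bullet> (S *v (y /\<^sub>R norm y))"
      by (intro min) simp
    also have "\<dots> = (y \<bullet> (S *v y)) / (y \<bullet> y)"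
      by (simp add: linear_scale dot_square_norm power2_eq_square field_simps)
    finally show ?thesis
      using False by (simp add: field_simps)
  qed simp
  with pos show ?thesis
    by (rule that)
qed

lemma matrix_upper_bound:
  fixes S :: "real^'m^'m"
  obtains s where "s \<ge> 0" "\<And>x. norm (S *v x) \<le> s * norm x"
  using onorm_pos_le[OF matrix_vector_mul_bounded_linear[of S]] onorm[OF matrix_vector_mul_bounded_linear[of S]]
  by (rule that)

text \<open>The matrix \<open>transpose W ** W\<close> is positive definite because \<open>W\<close>
  has trivial kernel, so the previous bound applies to it.\<close>

lemma invertible_lower_bound:
  fixes W :: "real^'m^'m"
  assumes "invertible W"
  obtains m where "m > 0" "\<And>x. m * (x \<bullet> x) \<le> (W *v x) \<bullet> (W *v x)"
proof -
  have inner: "x \<bullet> ((transpose W ** W) *v x) = (W *v x) \<bullet> (W *v x)" for x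
    using transpose_inner[of W "W *v x" x] by (simp only: matrix_vector_mul_assoc[symmetric] inner_commute)
  have "x = 0" if "W *v x = 0" for x
    using assms that unfolding invertible_left_inverse matrix_left_invertible_ker by blast
  then have "pos_def (transpose W ** W)"
    unfolding pos_def_def inner by (auto simp: matrix_transpose_mul)
  from pos_def_lower_bound[OF this]
  obtain m where "m > 0" "\<And>x. m * (x \<bullet> x) \<le> x \<bullet> ((transpose W ** W) *v x)"
    by blast
  then show ?thesis
    unfolding inner by (rule that)
qed

lemma lyapunov_derivative:
  fixes V W :: "real^'m^'m"
  assumes W: "transpose W = W"
    and y: "((\<lambda>t. fst (z t)) has_vector_derivative snd (z t)) (at t within T)"
    and p: "((\<lambda>t. snd (z t)) has_vector_derivative - (V *v snd (z t) + W *v fst (z t))) (at t within T)"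
  shows "((\<lambda>t. lyapunov \<epsilon> W (z t)) has_real_derivative lyapunov' \<epsilon> V W (z t)) (at t within T)"
proof -
  let ?y = "fst (z t)" and ?p = "snd (z t)"
  let ?p' = "- (V *v ?p + W *v ?y)"
  note in_deriv = bounded_bilinear.has_vector_derivative[OF bounded_bilinear_inner]
  have Wy: "((\<lambda>t. W *v fst (z t)) has_vector_derivative W *v ?p) (at t within T)"
    by (rule bounded_linear.has_vector_derivative[OF matrix_vector_mul_bounded_linear y])
  have "((\<lambda>t. lyapunov \<epsilon> W (z t)) has_vector_derivative
      (?p \<bullet> ?p' + ?p' \<bullet> ?p) + (?y \<bullet> (W *v ?p) + ?p \<bullet> (W *v ?y))
      + 2 * \<epsilon> * (?p \<bullet> (W *v ?p) + ?p' \<bullet> (W *v ?y))) (at t within T)"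
    unfolding lyapunov_def
    by (intro has_vector_derivative_add in_deriv p y Wy
        bounded_linear.has_vector_derivative[OF bounded_linear_mult_right])
  moreover have "(?p \<bullet> ?p' + ?p' \<bullet> ?p) + (?y \<bullet> (W *v ?p) + ?p \<bullet> (W *v ?y))
      + 2 * \<epsilon> * (?p \<bullet> (W *v ?p) + ?p' \<bullet> (W *v ?y)) = lyapunov' \<epsilon> V W (z t)"
  proof -
    have 1: "?y \<bullet> (W *v ?p) = ?p \<bullet> (W *v ?y)"
      using symmetric_matrix_inner[OF W, of ?y ?p] by (simp only: inner_commute)
    have 2: "?p \<bullet> (transpose V *v ?p) = ?p \<bullet> (V *v ?p)"
      using transpose_inner[of V ?p ?p] by (simp only: inner_commute)
    show ?thesis
      unfolding lyapunov'_def
      by (simp only: 1 2 inner_minus_left inner_minus_right inner_add_left inner_add_right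
          matrix_vector_mult_add_rdistrib inner_commute[of "V *v ?p" ?p] inner_commute[of "W *v ?y" ?p])
        (simp add: algebra_simps)
  qed
  ultimately show ?thesis
    by (simp add: has_real_derivative_iff_has_vector_derivative)
qed

text \<open>Damping alone controls only p. The cross term contributes -2 \<epsilon> |W y|^2; half of
  it absorbs the mixed term by Young's inequality, and the rest controls |y|^2 because
  \<open>W\<close> is invertible. The price, at most \<epsilon> r |p|^2, is covered by half of the
  damping when \<epsilon> is small.\<close>

lemma lyapunov'_bound:
  fixes V W :: "real^'m^'m"
  assumes V: "pos_def (V + transpose V)" and W: "invertible W"
  obtains e where "e > 0"
    "\<And>\<epsilon>. 0 < \<epsilon> \<Longrightarrow> \<epsilon> \<le> e \<Longrightarrow> \<exists>k>0. \<forall>z. lyapunov' \<epsilon> V W z \<le> - k * (z \<bullet> z)"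
proof -
  obtain d where d: "d > 0" "\<And>x. d * (x \<bullet> x) \<le> x \<bullet> ((V + transpose V) *v x)"
    using pos_def_lower_bound[OF V] by blast
  obtain m where m: "m > 0" "\<And>x. m * (x \<bullet> x) \<le> (W *v x) \<bullet> (W *v x)"
    using invertible_lower_bound[OF W] by blast
  obtain v where v: "v \<ge> 0" "\<And>x. norm (V *v x) \<le> v * norm x"
    using matrix_upper_bound[of V] by blast
  obtain w where w: "w \<ge> 0" "\<And>x. norm (W *v x) \<le> w * norm x"
    using matrix_upper_bound[of W] by blast
  \<comment> \<open>Here \<open>2 * w\<close> pays for p . W p and \<open>v\<^sup>2\<close> for the
    mixed term; the 1 makes \<open>r\<close> positive, so that division by it is possible.\<close>
  define r where "r = v\<^sup>2 + 2 * w + 1"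
  have r: "r > 0"
    using w(1) by (simp add: r_def add_nonneg_pos)
  show ?thesis
  proof (rule that[of "d / (2 * r)"])
    show "d / (2 * r) > 0"
      using d(1) r by simp
    fix \<epsilon> assume \<epsilon>: "0 < \<epsilon>" "\<epsilon> \<le> d / (2 * r)"
    then have er: "\<epsilon> * r \<le> d / 2"
      using r by (simp add: field_simps)
    define k where "k = min (d / 2) (\<epsilon> * m)"
    have "lyapunov' \<epsilon> V W z \<le> - k * (z \<bullet> z)" for z :: "(real^'m) \<times> (real^'m)"
    proof -
      obtain y p where z: "z = (y, p)"
        by fastforce
      let ?u = "W *v y"
      have "p \<bullet> (W *v p) \<le> norm p * norm (W *v p)"
        by (rule norm_cauchy_schwarz)
      also have "\<dots> \<le> norm p * (w * norm p)"
        by (intro mult_left_mono w) simp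
      finally have 1: "p \<bullet> (W *v p) \<le> w * (p \<bullet> p)"
        by (simp add: dot_square_norm power2_eq_square mult_ac)
      have "(V *v p) \<bullet> (V *v p) \<le> (v * norm p)\<^sup>2"
        unfolding dot_square_norm by (intro power_mono v) simp
      then have Vp: "(V *v p) \<bullet> (V *v p) \<le> v\<^sup>2 * (p \<bullet> p)"
        by (simp add: dot_square_norm power_mult_distrib)
      have "0 \<le> (V *v p + ?u) \<bullet> (V *v p + ?u)"
        by simp
      also have "\<dots> = (V *v p) \<bullet> (V *v p) + 2 * ((V *v p) \<bullet> ?u) + ?u \<bullet> ?u"
        by (simp add: inner_add_left inner_add_right inner_commute)
      finally have 2: "- 2 * ((V *v p) \<bullet> ?u) \<le> v\<^sup>2 * (p \<bullet> p) + ?u \<bullet> ?u"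
        using Vp by linarith
      have "2 * (p \<bullet> (W *v p) - (V *v p) \<bullet> ?u - ?u \<bullet> ?u) \<le> 2 * w * (p \<bullet> p) + v\<^sup>2 * (p \<bullet> p) - ?u \<bullet> ?u"
        using 1 2 by (simp add: algebra_simps)
      also have "\<dots> \<le> r * (p \<bullet> p) - m * (y \<bullet> y)"
        using m(2)[of y] inner_ge_zero[of p] unfolding r_def distrib_right by linarith
      finally have "\<epsilon> * (2 * (p \<bullet> (W *v p) - (V *v p) \<bullet> ?u - ?u \<bullet> ?u)) \<le> \<epsilon> * (r * (p \<bullet> p) - m * (y \<bullet> y))"
        using \<epsilon>(1) by (intro mult_left_mono) auto
      also have "\<dots> = (\<epsilon> * r) * (p \<bullet> p) - \<epsilon> * m * (y \<bullet> y)"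
        by (simp add: algebra_simps)
      also have "\<dots> \<le> d / 2 * (p \<bullet> p) - \<epsilon> * m * (y \<bullet> y)"
        using er by (intro diff_right_mono mult_right_mono) auto
      finally have "lyapunov' \<epsilon> V W z \<le> - (d * (p \<bullet> p)) + (d / 2 * (p \<bullet> p) - \<epsilon> * m * (y \<bullet> y))"
        using d(2)[of p] unfolding lyapunov'_def z fst_conv snd_conv
        by (intro add_mono) (simp_all add: mult.assoc mult.left_commute)
      also have "\<dots> = - (d / 2 * (p \<bullet> p) + \<epsilon> * m * (y \<bullet> y))"
        by simp
      also have "\<dots> \<le> - (k * (p \<bullet> p) + k * (y \<bullet> y))"
        unfolding neg_le_iff_le k_def by (intro add_mono mult_right_mono) auto
      also have "\<dots> = - k * (z \<bullet> z)"
        by (simp add: z inner_Pair algebra_simps)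
      finally show ?thesis .
    qed
    moreover have "k > 0"
      using d(1) m(1) \<epsilon>(1) by (simp add: k_def)
    ultimately show "\<exists>k>0. \<forall>z. lyapunov' \<epsilon> V W z \<le> - k * (z \<bullet> z)"
      by blast
  qed
qed

lemma abs_inner_matrix_le:
  fixes W :: "real^'m^'m"
  assumes w: "\<And>x. norm (W *v x) \<le> w * norm x" "w \<ge> 0"
  shows "\<bar>p \<bullet> (W *v y)\<bar> \<le> w * (y \<bullet> y + p \<bullet> p) / 2"
proof -
  have "\<bar>p \<bullet> (W *v y)\<bar> \<le> norm p * norm (W *v y)"
    by (rule Cauchy_Schwarz_ineq2)
  also have "\<dots> \<le> norm p * (w * norm y)"
    by (intro mult_left_mono w) simp
  also have "\<dots> = w * (norm p * norm y)"
    by simp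
  also have "\<dots> \<le> w * ((y \<bullet> y + p \<bullet> p) / 2)"
    using sum_squares_bound[of "norm p" "norm y"]
    by (intro mult_left_mono w) (simp add: dot_square_norm)
  finally show ?thesis
    by simp
qed

lemma lyapunov_upper_bound:
  fixes W :: "real^'m^'m"
  obtains M where "M > 0" "\<And>z. \<bar>lyapunov \<epsilon> W z\<bar> \<le> M * (z \<bullet> z)"
proof -
  obtain w where w: "w \<ge> 0" "\<And>x. norm (W *v x) \<le> w * norm x"
    using matrix_upper_bound[of W] by blast
  note W = abs_inner_matrix_le[OF w(2,1)]
  have "\<bar>lyapunov \<epsilon> W z\<bar> \<le> (1 + w + \<bar>\<epsilon>\<bar> * w) * (z \<bullet> z)" for z :: "(real^'m) \<times> (real^'m)"
  proof -
    obtain y p where z: "z = (y, p)"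
      by fastforce
    have "\<bar>lyapunov \<epsilon> W z\<bar> \<le> p \<bullet> p + \<bar>y \<bullet> (W *v y)\<bar> + 2 * \<bar>\<epsilon>\<bar> * \<bar>p \<bullet> (W *v y)\<bar>"
      unfolding lyapunov_def z fst_conv snd_conv
      by (intro order.trans[OF abs_triangle_ineq] add_mono) (simp_all add: abs_mult)
    also have "\<dots> \<le> p \<bullet> p + w * (y \<bullet> y + y \<bullet> y) / 2 + 2 * \<bar>\<epsilon>\<bar> * (w * (y \<bullet> y + p \<bullet> p) / 2)"
      by (intro add_mono mult_left_mono W) auto
    also have "\<dots> \<le> (1 + w + \<bar>\<epsilon>\<bar> * w) * (z \<bullet> z)"
      using w(1) by (simp add: z inner_Pair algebra_simps)
    finally show ?thesis .
  qed
  moreover have "1 + w + \<bar>\<epsilon>\<bar> * w > 0"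
    using w(1) by (intro add_pos_nonneg) auto
  ultimately show ?thesis
    by (rule that[rotated])
qed

lemma lyapunov_lower_bound:
  fixes W :: "real^'m^'m"
  assumes W: "pos_def W"
  obtains e k where "e > 0" "k > 0" "\<And>\<epsilon> z. 0 < \<epsilon> \<Longrightarrow> \<epsilon> \<le> e \<Longrightarrow> k * (z \<bullet> z) \<le> lyapunov \<epsilon> W z"
proof -
  obtain w where w: "w \<ge> 0" "\<And>x. norm (W *v x) \<le> w * norm x"
    using matrix_upper_bound[of W] by blast
  obtain d where d: "d > 0" "\<And>x. d * (x \<bullet> x) \<le> x \<bullet> (W *v x)"
    using pos_def_lower_bound[OF W] by blast
  \<comment> \<open>The energy part is at least 2 k |z|^2, and the cross term may consume k |z|^2 of
    it. The restriction of \<epsilon> to \<open>k / (w + 1)\<close> ensures this and covers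
    \<open>w\<close> = 0.\<close>
  define k where "k = min 1 d / 2"
  have k: "k > 0"
    using d(1) by (simp add: k_def)
  show ?thesis
  proof (rule that[of "k / (w + 1)" k])
    show "k / (w + 1) > 0" "k > 0"
      using k w(1) by simp_all
    fix \<epsilon> and z :: "(real^'m) \<times> (real^'m)"
    assume \<epsilon>: "0 < \<epsilon>" "\<epsilon> \<le> k / (w + 1)"
    obtain y p where z: "z = (y, p)"
      by fastforce
    have "\<epsilon> * w \<le> \<epsilon> * (w + 1)"
      using \<epsilon> by simp
    also have "\<dots> \<le> k"
      using \<epsilon> w(1) by (simp add: field_simps)
    finally have ew: "\<epsilon> * w \<le> k" .
    have "- (2 * \<epsilon> * (p \<bullet> (W *v y))) = 2 * \<epsilon> * (- (p \<bullet> (W *v y)))"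
      by simp
    also have "\<dots> \<le> 2 * \<epsilon> * \<bar>p \<bullet> (W *v y)\<bar>"
      using \<epsilon>(1) abs_ge_minus_self[of "p \<bullet> (W *v y)"] by (intro mult_left_mono) auto
    also have "\<dots> \<le> 2 * \<epsilon> * (w * (y \<bullet> y + p \<bullet> p) / 2)"
      using \<epsilon>(1) abs_inner_matrix_le[OF w(2,1), of p y] by (intro mult_left_mono) auto
    also have "\<dots> = (\<epsilon> * w) * (y \<bullet> y + p \<bullet> p)"
      by simp
    also have "\<dots> \<le> k * (y \<bullet> y + p \<bullet> p)"
      using ew by (intro mult_right_mono) auto
    finally have 1: "- (2 * \<epsilon> * (p \<bullet> (W *v y))) \<le> k * (y \<bullet> y) + k * (p \<bullet> p)"
      by (simp add: distrib_left)
    have "2 * k * (p \<bullet> p) \<le> 1 * (p \<bullet> p)" "2 * k * (y \<bullet> y) \<le> d * (y \<bullet> y)"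
      by (intro mult_right_mono, simp_all add: k_def)+
    then show "k * (z \<bullet> z) \<le> lyapunov \<epsilon> W z"
      using 1 d(2)[of y] unfolding lyapunov_def z fst_conv snd_conv inner_Pair distrib_left by linarith
  qed
qed

text \<open>Gronwall's argument: F(t) exp(-c t) has nonpositive derivative. Neither \<open>c\<close>
  nor \<open>F\<close> has a prescribed sign, so the bound gives decay for negative \<open>c\<close>
  and divergence for positive \<open>c\<close> and negative F(0).\<close>

lemma exp_growth_bound:
  fixes F :: "real \<Rightarrow> real"
  assumes F: "\<And>t. t \<ge> 0 \<Longrightarrow> (F has_real_derivative F' t) (at t within {0..})"
    and le: "\<And>t. t \<ge> 0 \<Longrightarrow> F' t \<le> c * F t" and t: "t \<ge> 0"
  shows "F t \<le> F 0 * exp (c * t)"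
proof -
  let ?g = "\<lambda>t. F t * exp (- c * t)"
  have deriv: "(?g has_real_derivative (F' s - c * F s) * exp (- c * s)) (at s within {0..})" if "s \<ge> 0" for s
    by (rule derivative_eq_intros F[OF that] refl | simp add: algebra_simps)+
  have "?g t \<le> ?g 0"
  proof (rule DERIV_nonpos_imp_decreasing_open[OF t])
    fix s assume s: "0 < s" "s < t"
    then have "at s within {0..} = at s"
      by (intro at_within_interior) (simp add: interior_real_atLeast)
    then have "(?g has_real_derivative (F' s - c * F s) * exp (- c * s)) (at s)"
      using deriv[of s] s by simp
    moreover have "(F' s - c * F s) * exp (- c * s) \<le> 0"
      using le[of s] s by (intro mult_nonpos_nonneg) auto
    ultimately show "\<exists>y. (?g has_real_derivative y) (at s) \<and> y \<le> 0"
      by blast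
  next
    have "continuous_on {0..} ?g"
      using deriv by (intro DERIV_continuous_on) auto
    then show "continuous_on {0..t} ?g"
      by (rule continuous_on_subset) auto
  qed
  then have "?g t * exp (c * t) \<le> F 0 * exp (c * t)"
    by simp
  then show ?thesis
    by (simp add: mult.assoc flip: exp_add)
qed

section \<open>The transfer between the two systems\<close>

definition damped_solution ::
    "real^'m^'m \<Rightarrow> real^'m^'m \<Rightarrow> (real \<Rightarrow> (real^'m) \<times> (real^'m)) \<Rightarrow> bool" where
  "damped_solution V W z \<longleftrightarrow>
     (\<forall>t\<ge>0. ((\<lambda>s. fst (z s)) has_vector_derivative snd (z t)) (at t within {0..}) \<and>
       ((\<lambda>s. snd (z s)) has_vector_derivative - (V *v snd (z t) + W *v fst (z t))) (at t within {0..}))"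

lemma damped_solution_lyapunov:
  fixes V W :: "real^'m^'m"
  assumes "damped_solution V W z" "transpose W = W" "t \<ge> 0"
  shows "((\<lambda>t. lyapunov \<epsilon> W (z t)) has_real_derivative lyapunov' \<epsilon> V W (z t)) (at t within {0..})"
  using assms unfolding damped_solution_def by (intro lyapunov_derivative) simp_all

lemma damped_solution_decay:
  fixes V W :: "real^'m^'m"
  assumes V: "pos_def (V + transpose V)" and W: "pos_def W"
  obtains C c where "C > 0" "c > 0"
    "\<And>z t. damped_solution V W z \<Longrightarrow> t \<ge> 0 \<Longrightarrow> norm (z t) \<le> C * exp (- c * t) * norm (z 0)"
proof -
  have Wt: "transpose W = W"
    using W by (simp add: pos_def_def)
  obtain e where e: "e > 0"
      "\<And>\<epsilon>. 0 < \<epsilon> \<Longrightarrow> \<epsilon> \<le> e \<Longrightarrow> \<exists>k>0. \<forall>z. lyapunov' \<epsilon> V W z \<le> - k * (z \<bullet> z)"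
    using lyapunov'_bound[OF V pos_def_invertible[OF W]] by blast
  obtain e' k' where k': "e' > 0" "k' > 0" "\<And>\<epsilon> z. 0 < \<epsilon> \<Longrightarrow> \<epsilon> \<le> e' \<Longrightarrow> k' * (z \<bullet> z) \<le> lyapunov \<epsilon> W z"
    using lyapunov_lower_bound[OF W] by blast
  define \<epsilon> where "\<epsilon> = min e e'"
  have \<epsilon>: "0 < \<epsilon>" "\<epsilon> \<le> e" "\<epsilon> \<le> e'"
    using e(1) k'(1) by (auto simp: \<epsilon>_def)
  obtain k where k: "k > 0" "\<And>z. lyapunov' \<epsilon> V W z \<le> - k * (z \<bullet> z)"
    using e(2)[OF \<epsilon>(1,2)] by blast
  obtain M where M: "M > 0" "\<And>z. \<bar>lyapunov \<epsilon> W z\<bar> \<le> M * (z \<bullet> z)"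
    using lyapunov_upper_bound[of \<epsilon> W] by blast
  \<comment> \<open>The Lyapunov function decays at rate k / M and is comparable to the squared
    norm, with constants \<open>k'\<close> and \<open>M\<close>. The norm therefore decays at half
    that rate, with the square root of the ratio as factor.\<close>
  let ?c = "k / (2 * M)" and ?C = "sqrt (M / k')"
  have bound: "norm (z t) \<le> ?C * exp (- ?c * t) * norm (z 0)"
    if z: "damped_solution V W z" and t: "t \<ge> 0" for z t
  proof -
    have "lyapunov' \<epsilon> V W (z s) \<le> - (k / M) * lyapunov \<epsilon> W (z s)" for s
    proof -
      have "lyapunov \<epsilon> W (z s) \<le> M * (z s \<bullet> z s)"
        using M(2)[of "z s"] by linarith
      then have "(k / M) * lyapunov \<epsilon> W (z s) \<le> (k / M) * (M * (z s \<bullet> z s))"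
        using k(1) M(1) by (intro mult_left_mono) simp_all
      also have "\<dots> = k * (z s \<bullet> z s)"
        using M(1) by simp
      finally show ?thesis
        using k(2)[of "z s"] by linarith
    qed
    from exp_growth_bound[OF damped_solution_lyapunov[OF z Wt] this t]
    have "lyapunov \<epsilon> W (z t) \<le> lyapunov \<epsilon> W (z 0) * exp (- (k / M) * t)"
      by simp
    also have "\<dots> \<le> (M * (z 0 \<bullet> z 0)) * exp (- (k / M) * t)"
      using M(2)[of "z 0"] by (intro mult_right_mono) auto
    finally have "k' * (z t \<bullet> z t) \<le> M * (z 0 \<bullet> z 0) * exp (- (k / M) * t)"
      using k'(3)[OF \<epsilon>(1,3), of "z t"] by linarith
    then have "(norm (z t))\<^sup>2 \<le> (M / k') * (norm (z 0))\<^sup>2 * exp (- (k / M) * t)"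
      using k'(2) by (simp add: dot_square_norm field_simps)
    also have "exp (- (k / M) * t) = (exp (- ?c * t))\<^sup>2"
      using M(1) by (simp add: power2_eq_square flip: exp_add)
    also have "(M / k') * (norm (z 0))\<^sup>2 * (exp (- ?c * t))\<^sup>2 = (?C * exp (- ?c * t) * norm (z 0))\<^sup>2"
      using M(1) k'(2) by (simp add: power_mult_distrib)
    finally show ?thesis
      by (rule power2_le_imp_le) (use M(1) k'(2) in simp)
  qed
  show ?thesis
    by (rule that[OF _ _ bound]) (use k(1) M(1) k'(2) in simp_all)
qed

text \<open>From F' <= -k |z|^2 <= (k / M) F, a negative F(0) drives F exponentially to minus
  infinity, whereas a bound K on the solution keeps F above -M K^2.\<close>

lemma damped_solution_unbounded:
  fixes V W :: "real^'m^'m"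
  assumes V: "pos_def (V + transpose V)" and W: "transpose W = W" "invertible W"
    and z: "damped_solution V W z" and z0: "snd (z 0) = 0" "fst (z 0) \<bullet> (W *v fst (z 0)) < 0"
    and bounded: "\<And>t. t \<ge> 0 \<Longrightarrow> norm (z t) \<le> K"
  shows False
proof -
  obtain e where e: "e > 0"
      "\<And>\<epsilon>. 0 < \<epsilon> \<Longrightarrow> \<epsilon> \<le> e \<Longrightarrow> \<exists>k>0. \<forall>z. lyapunov' \<epsilon> V W z \<le> - k * (z \<bullet> z)"
    using lyapunov'_bound[OF V W(2)] by blast
  obtain k where k: "k > 0" "\<And>z. lyapunov' e V W z \<le> - k * (z \<bullet> z)"
    using e by blast
  obtain M where M: "M > 0" "\<And>z. \<bar>lyapunov e W z\<bar> \<le> M * (z \<bullet> z)"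
    using lyapunov_upper_bound[of e W] by blast
  have neg: "lyapunov e W (z 0) < 0"
    using z0 by (simp add: lyapunov_def)
  have decay: "lyapunov' e V W (z s) \<le> (k / M) * lyapunov e W (z s)" for s
  proof -
    have "- lyapunov e W (z s) \<le> M * (z s \<bullet> z s)"
      using M(2)[of "z s"] by linarith
    then have "(k / M) * (- lyapunov e W (z s)) \<le> (k / M) * (M * (z s \<bullet> z s))"
      using k(1) M(1) by (intro mult_left_mono) simp_all
    also have "\<dots> = k * (z s \<bullet> z s)"
      using M(1) by simp
    finally show ?thesis
      using k(2)[of "z s"] by simp
  qed
  \<comment> \<open>Chosen so that \<open>lyapunov e W (z 0) * (k / M * t)\<close> equals
    \<open>- (M * K\<^sup>2)\<close>.\<close>
  define t where "t = (M * K\<^sup>2 / - lyapunov e W (z 0)) / (k / M)"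
  have t: "t \<ge> 0"
    using k(1) M(1) neg unfolding t_def by (intro divide_nonneg_nonneg mult_nonneg_nonneg) auto
  have "- (M * K\<^sup>2) \<le> - (M * (z t \<bullet> z t))"
    using M(1) bounded[OF t] by (simp add: dot_square_norm power_mono)
  also have "\<dots> \<le> lyapunov e W (z t)"
    using M(2)[of "z t"] by linarith
  also have "\<dots> \<le> lyapunov e W (z 0) * exp (k / M * t)"
    by (rule exp_growth_bound[OF damped_solution_lyapunov[OF z W(1)] decay t])
  also have "\<dots> \<le> lyapunov e W (z 0) * (1 + k / M * t)"
    using neg exp_ge_add_one_self by (intro mult_left_mono_neg) simp_all
  also have "\<dots> = lyapunov e W (z 0) - M * K\<^sup>2"
    using k(1) M(1) neg by (simp add: t_def field_simps)
  finally show False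
    using neg by simp
qed

text \<open>The exponential of the first-order operator supplies the solution. The instability proof
  needs one with a prescribed initial state.\<close>

lemma second_order_solution_exists:
  fixes J K L :: "real^'m^'m"
  assumes "invertible J"
  shows "\<exists>z. second_order_solution J K L z \<and> z 0 = z0"
proof -
  let ?f = "\<lambda>z. (snd z, - (matrix_inv J *v (K *v snd z + L *v fst z)))"
  have lin: "bounded_linear ?f"
    by (intro bounded_linear_Pair bounded_linear_snd bounded_linear_minus
        bounded_linear_compose[OF matrix_vector_mul_bounded_linear] bounded_linear_add bounded_linear_fst)
  let ?T = "endo_of ?f"
  define z where "z t = exp (t *\<^sub>R ?T) \<bullet>\<bullet> z0" for t
  have deriv: "(z has_vector_derivative ?f (z t)) (at t within {0..})" for t
  proof -
    have "(z has_vector_derivative ?T \<bullet>\<bullet> z t) (at t)"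
      using bounded_linear.has_vector_derivative[OF app.bounded_linear_left[of z0]
          exp_scaleR_has_vector_derivative_left[of ?T t]]
      unfolding z_def[abs_def] by simp
    then show ?thesis
      unfolding app_endo_of[OF lin] by (rule has_vector_derivative_at_within)
  qed
  have "J *v (- (matrix_inv J *v (K *v snd (z t) + L *v fst (z t)))) + K *v snd (z t) + L *v fst (z t) = 0" for t
    by (simp add: linear_neg matrix_vector_mul_assoc matrix_inv_inverse[OF assms])
  moreover have "((\<lambda>s. fst (z s)) has_vector_derivative snd (z t)) (at t within {0..})"
    "((\<lambda>s. snd (z s)) has_vector_derivative - (matrix_inv J *v (K *v snd (z t) + L *v fst (z t)))) (at t within {0..})" for t
    using bounded_linear.has_vector_derivative[OF bounded_linear_fst deriv[of t]]
      bounded_linear.has_vector_derivative[OF bounded_linear_snd deriv[of t]] by simp_all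
  ultimately have "second_order_solution J K L z"
    unfolding second_order_solution_def by blast
  then show ?thesis
    by (intro exI[of _ z]) (simp add: z_def)
qed

lemma mop_scaled_exp_bounded:
  fixes A :: "real^'m^'m"
  obtains c where "\<And>t x. norm (exp (t *\<^sub>R ((1/2) *\<^sub>R mop A - (1/2) *\<^sub>R mop (real_part A))) \<bullet>\<bullet> x) \<le> c * norm x"
proof -
  obtain c where c: "\<And>t x. norm (exp (t *\<^sub>R mop (A - real_part A)) \<bullet>\<bullet> x) \<le> c * norm x"
    using exp_imaginary_part_bounded[of A] by blast
  show ?thesis
    by (rule that[of c]) (use c[of "_ / 2"] in \<open>simp add: mop_diff scaleR_diff_right[symmetric] del: scaleR_diff_right\<close>)
qed

text \<open>After cancellation of the real parts only bounded exponentials remain. The general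
  \<open>M\<close> lets the bound serve twice: for the transfer with the inverse of C, and for its
  inverse with C and the roles of A and V exchanged.\<close>

lemma conj_exp_mop_bounded:
  fixes A V M :: "real^'m^'m"
  assumes "M ** real_part A = real_part V ** M"
  obtains r where "\<And>t x. norm (conj_exp ((1/2) *\<^sub>R mop V) (mop M) ((1/2) *\<^sub>R mop A) t \<bullet>\<bullet> x) \<le> r * norm x"
proof -
  let ?h = "\<lambda>X :: real^'m^'m. (1/2) *\<^sub>R mop X"
  have comm: "?h (real_part X) * ?h X = ?h X * ?h (real_part X)" for X :: "real^'m^'m"
    using real_part_commute[of X] by (simp flip: mop_mult)
  have M: "mop M * ?h (real_part A) = ?h (real_part V) * mop M"
    using assms by (simp flip: mop_mult)
  obtain ca where ca: "\<And>t x. norm (exp (t *\<^sub>R (?h A - ?h (real_part A))) \<bullet>\<bullet> x) \<le> ca * norm x"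
    using mop_scaled_exp_bounded[of A] by blast
  obtain cv where cv: "\<And>t x. norm (exp (t *\<^sub>R (?h V - ?h (real_part V))) \<bullet>\<bullet> x) \<le> cv * norm x"
    using mop_scaled_exp_bounded[of V] by blast
  have "norm (conj_exp (?h V) (mop M) (?h A) t \<bullet>\<bullet> x) \<le> \<bar>cv\<bar> * norm (mop M) * \<bar>ca\<bar> * norm x" for t x
    unfolding conj_exp_real_part[OF comm comm M] by (rule conj_exp_bounded[OF ca cv])
  then show ?thesis
    by (rule that)
qed

text \<open>Moving C' to the left gives Phi = C' E with E = exp(-t u) exp(t a) and u = C v C'. The
  commutator conditions make E commute with B - A^2/4, and conjugation by C turns that matrix into W
  - V^2/4.\<close>

lemma conj_exp_intertwines:
  fixes A B V W C C' :: "real^'m^'m"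
  assumes C: "C ** C' = mat 1" "C' ** C = mat 1"
    and comm: "\<And>n. n \<le> CARD('m)\<^sup>2 - 1 \<Longrightarrow>
           iter_commutator (4 *\<^sub>R B - A ** A) (replicate n A @ [C ** V ** C' - A]) = 0"
    and W: "W = (1/4) *\<^sub>R (V ** V) + C' ** (B - (1/4) *\<^sub>R (A ** A)) ** C"
  defines "a \<equiv> (1/2) *\<^sub>R mop A" and "v \<equiv> (1/2) *\<^sub>R mop V"
  shows "conj_exp v (mop C') a t * (mop B - a * a) = (mop W - v * v) * conj_exp v (mop C') a t"
proof -
  let ?Z = "4 *\<^sub>R B - A ** A" and ?N = "C ** V ** C' - A"
  let ?T = "\<lambda>X. commutator X A"
  let ?c = "mop C'" and ?c' = "mop C"
  have c: "?c' * ?c = 1" "?c * ?c' = 1"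
    using C by (simp_all add: mop_one flip: mop_mult)
  have "commutator ((?T ^^ n) ?Z) ?N = 0" for n
  proof (rule linear_funpow_eq_0[OF linear_commutator linear_commutator])
    fix n assume "n < DIM(real^'m^'m)"
    then have "n \<le> CARD('m)\<^sup>2 - 1"
      by (simp add: power2_eq_square)
    from comm[OF this] show "commutator ((?T ^^ n) ?Z) ?N = 0"
      by (simp only: iter_commutator_replicate)
  qed
  then have "mop (commutator ((?T ^^ n) ?Z) ?N) = 0" for n
    using mop_diff[of 0 0] by simp
  then have zero: "mop ((?T ^^ n) ?Z) * mop ?N = mop ?N * mop ((?T ^^ n) ?Z)" for n
    by (simp add: mop_commutator)
  define u where "u = ?c' * v * ?c"
  \<comment> \<open>The factor \<open>(t / 2) ^ n\<close> turns commutators with A into commutators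
    with t a = (t/2) A, and the division by 4 makes \<open>Y 0\<close> equal to B - A^2/4.\<close>
  define Y where "Y n = ((t / 2) ^ n / 4) *\<^sub>R mop ((?T ^^ n) ?Z)" for n
  define E where "E = exp (- (t *\<^sub>R u)) * exp (t *\<^sub>R a)"
  have N: "t *\<^sub>R u - t *\<^sub>R a = (t / 2) *\<^sub>R mop ?N"
    by (simp add: u_def v_def a_def mop_diff mop_mult scaleR_diff_right)
  have "E * Y 0 = Y 0 * E"
    unfolding E_def
  proof (rule exp_mult_exp_commute)
    show "Y (Suc n) = Y n * (t *\<^sub>R a) - (t *\<^sub>R a) * Y n" for n
      by (simp add: Y_def a_def mop_commutator scaleR_diff_right mult.commute)
    show "Y n * (t *\<^sub>R u - t *\<^sub>R a) = (t *\<^sub>R u - t *\<^sub>R a) * Y n" for n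
      unfolding N by (simp add: Y_def zero)
  qed
  moreover have Y0: "Y 0 = mop B - a * a"
    by (simp add: Y_def a_def mop_diff mop_mult mop_scaleR scaleR_diff_right)
  ultimately have EK: "E * (mop B - a * a) = (mop B - a * a) * E"
    by simp
  have "- (t *\<^sub>R v) * ?c = ?c * - (t *\<^sub>R u)"
    using c(2) by (simp add: u_def flip: mult.assoc)
  then have "exp (- (t *\<^sub>R v)) * ?c = ?c * exp (- (t *\<^sub>R u))"
    by (rule exp_intertwine)
  then have \<Phi>: "conj_exp v ?c a t = ?c * E"
    by (simp add: conj_exp_def E_def mult.assoc)
  have "mop W - v * v = ?c * (mop B - a * a) * ?c'"
    by (simp add: W mop_add mop_scaleR mop_mult mop_diff v_def a_def)
  then have "(mop W - v * v) * conj_exp v ?c a t = ?c * (mop B - a * a) * (?c' * ?c) * E"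
    unfolding \<Phi> by (simp only: mult.assoc)
  also have "\<dots> = ?c * ((mop B - a * a) * E)"
    by (simp only: c mult_1_right mult.assoc)
  also have "\<dots> = conj_exp v ?c a t * (mop B - a * a)"
    unfolding \<Phi> EK[symmetric] by (simp only: mult.assoc)
  finally show ?thesis
    by simp
qed

text \<open>Multiplying the equation by \<open>N\<close> and using N J = S gives \<xi>'' + A \<xi>'
  + B \<xi> = 0 for \<xi> = S x, to which the operator form of the transfer applies.\<close>

lemma second_order_solution_transfer:
  fixes J D L A B V W C C' :: "real^'m^'m"
  assumes S: "S ** S = J" "S ** N = mat 1" "N ** S = mat 1"
    and A: "A = N ** D ** N" and B: "B = N ** L ** N"
  defines "a \<equiv> (1/2) *\<^sub>R mop A" and "v \<equiv> (1/2) *\<^sub>R mop V"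
  assumes inter: "\<And>t. conj_exp v c a t * (mop B - a * a) = (mop W - v * v) * conj_exp v c a t"
    and z: "second_order_solution J D L z"
  shows "damped_solution V W (\<lambda>t. conj_transfer v c a t (S *v fst (z t), S *v snd (z t)))"
  unfolding damped_solution_def
proof (intro allI impI)
  fix t :: real
  assume t: "t \<ge> 0"
  have aa: "(a + a) \<bullet>\<bullet> x = A *v x" for x
    by (simp add: a_def app.add_left app.scaleR_left flip: scaleR_add_left)
  have vv: "(v + v) \<bullet>\<bullet> x = V *v x" for x
    by (simp add: v_def app.add_left app.scaleR_left flip: scaleR_add_left)
  let ?x = "\<lambda>s. S *v fst (z s)" and ?p = "\<lambda>s. S *v snd (z s)"
  obtain r where r: "((\<lambda>s. snd (z s)) has_vector_derivative r) (at t within {0..})"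
      and eq: "J *v r + D *v snd (z t) + L *v fst (z t) = 0"
    and x: "((\<lambda>s. fst (z s)) has_vector_derivative snd (z t)) (at t within {0..})"
    using z t unfolding second_order_solution_def by blast
  have NS: "N *v (S *v y) = y" for y
    by (simp add: matrix_vector_mul_assoc S)
  have "J *v r = - (D *v snd (z t) + L *v fst (z t))"
    using eq unfolding add.assoc by (rule eq_neg_iff_add_eq_0[THEN iffD2])
  then have "N *v (J *v r) = - (N *v (D *v snd (z t)) + N *v (L *v fst (z t)))"
    by (simp add: linear_neg matrix_vector_right_distrib linear_diff)
  moreover have "N *v (J *v r) = S *v r"
    unfolding S(1)[symmetric] matrix_vector_mul_assoc[symmetric] NS ..
  ultimately have "S *v r = - ((a + a) \<bullet>\<bullet> ?p t + mop B \<bullet>\<bullet> ?x t)"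
    unfolding aa app_mop A B matrix_vector_mul_assoc[symmetric] NS by simp
  then have p: "(?p has_vector_derivative - ((a + a) \<bullet>\<bullet> ?p t + mop B \<bullet>\<bullet> ?x t)) (at t within {0..})"
    using bounded_linear.has_vector_derivative[OF matrix_vector_mul_bounded_linear[of S] r] by simp
  have x: "(?x has_vector_derivative ?p t) (at t within {0..})"
    by (rule bounded_linear.has_vector_derivative[OF matrix_vector_mul_bounded_linear x])
  show "((\<lambda>s. fst (conj_transfer v c a s (?x s, ?p s))) has_vector_derivative
        snd (conj_transfer v c a t (?x t, ?p t))) (at t within {0..}) \<and>
      ((\<lambda>s. snd (conj_transfer v c a s (?x s, ?p s))) has_vector_derivative
        - (V *v snd (conj_transfer v c a t (?x t, ?p t)) + W *v fst (conj_transfer v c a t (?x t, ?p t))))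
        (at t within {0..})"
    using second_order_transfer[OF inter x p] unfolding conj_transfer_def fst_conv snd_conv vv app_mop
    by blast
qed

lemma transpose_add: "transpose (A + B) = transpose A + transpose B"
  by (simp add: transpose_def vec_eq_iff)

lemma matrix_pair_bound:
  fixes S :: "real^'m^'m"
  obtains s where "s > 0" "\<And>x y. norm (S *v x, S *v y) \<le> s * norm (x, y)"
proof -
  have "bounded_linear (\<lambda>z. (S *v fst z, S *v snd z))"
    by (intro bounded_linear_Pair bounded_linear_compose[OF matrix_vector_mul_bounded_linear]
        bounded_linear_fst bounded_linear_snd)
  then obtain s where s: "s > 0" "\<And>z. norm (S *v fst z, S *v snd z) \<le> norm z * s"
    using bounded_linear.pos_bounded by blast
  show ?thesis
    using s(2)[of "(_, _)"] by (intro that[OF s(1)]) (simp add: mult.commute)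
qed

lemma null_asymptotically_stableI:
  assumes C: "C > 0" "c > 0"
    and decay: "\<And>z t. second_order_solution J K L z \<Longrightarrow> t \<ge> 0 \<Longrightarrow> norm (z t) \<le> C * exp (- c * t) * norm (z 0)"
  shows "null_asymptotically_stable J K L"
  unfolding null_asymptotically_stable_def null_stable_def
proof (intro conjI allI impI)
  fix \<epsilon> :: real assume \<epsilon>: "\<epsilon> > 0"
  show "\<exists>\<delta>>0. \<forall>z. second_order_solution J K L z \<and> norm (z 0) < \<delta> \<longrightarrow> (\<forall>t\<ge>0. norm (z t) < \<epsilon>)"
  proof (intro exI[of _ "\<epsilon> / C"] conjI allI impI)
    show "\<epsilon> / C > 0"
      using C(1) \<epsilon> by simp
    fix z and t :: real
    assume z: "second_order_solution J K L z \<and> norm (z 0) < \<epsilon> / C" and t: "t \<ge> 0"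
    have "norm (z t) \<le> C * exp (- c * t) * norm (z 0)"
      using decay z t by blast
    also have "\<dots> \<le> C * 1 * norm (z 0)"
      using C t by (intro mult_right_mono mult_left_mono) auto
    also have "\<dots> < \<epsilon>"
      using z C(1) by (simp add: field_simps)
    finally show "norm (z t) < \<epsilon>" .
  qed
next
  show "\<exists>\<delta>>0. \<forall>z. second_order_solution J K L z \<and> norm (z 0) < \<delta> \<longrightarrow> (z \<longlongrightarrow> 0) at_top"
  proof (intro exI[of _ 1] conjI allI impI)
    fix z assume z: "second_order_solution J K L z \<and> norm (z 0) < 1"
    have "((\<lambda>t. C * exp (- c * t) * norm (z 0)) \<longlongrightarrow> 0) at_top"
      using C(2) by real_asymp
    moreover have "\<forall>\<^sub>F t in at_top. norm (z t) \<le> C * exp (- c * t) * norm (z 0)"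
      using eventually_ge_at_top[of 0] by eventually_elim (use decay z in blast)
    ultimately show "(z \<longlongrightarrow> 0) at_top"
      by (rule Lim_null_comparison[rotated])
  qed simp
qed

lemma null_stableE:
  assumes "null_stable J K L" "\<epsilon> > 0"
  obtains \<delta> where "\<delta> > 0" "\<And>z t. second_order_solution J K L z \<Longrightarrow> norm (z 0) < \<delta> \<Longrightarrow> t \<ge> 0 \<Longrightarrow> norm (z t) < \<epsilon>"
  using assms unfolding null_stable_def by meson

section \<open>Stability and instability of the original system\<close>

theorem theorem8:
  fixes J D G P Q A B V C W :: "real^'m^'m"
  assumes "transpose J = J" and "pos_def J"
    and "transpose D = D" and "transpose Q = Q"
    and "transpose G = - G" and "transpose P = - P"
    and A: "A = inv_sqrt J ** (D + G) ** inv_sqrt J"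
    and B: "B = inv_sqrt J ** (P + Q) ** inv_sqrt J"
    and "det C \<noteq> 0" and "pos_def (V + transpose V)"
    and "C ** real_part V = real_part A ** C"
    and "\<And>n. n \<le> CARD('m)\<^sup>2 - 1 \<Longrightarrow>
           iter_commutator (4 *\<^sub>R B - A ** A)
             (replicate n A @ [C ** V ** matrix_inv C - A]) = 0"
    and "V ** V - transpose (V ** V) + matrix_inv C ** (4 *\<^sub>R B - A ** A) ** C
           - transpose C ** transpose (4 *\<^sub>R B - A ** A) ** transpose (matrix_inv C) = 0"
    and W: "W = (1/4) *\<^sub>R (V ** V) + matrix_inv C ** (B - (1/4) *\<^sub>R (A ** A)) ** C"
  shows "(pos_def W \<longrightarrow> null_asymptotically_stable J (D + G) (P + Q)) \<and>
         (invertible W \<and> (\<exists>l<0. \<exists>w. w \<noteq> 0 \<and> W *v w = l *\<^sub>R w) \<longrightarrow>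
            null_unstable J (D + G) (P + Q))"
proof -
  define S N where "S = pos_def_sqrt J" and "N = inv_sqrt J"
  define C' where "C' = matrix_inv C"
  define a v where "a = (1/2) *\<^sub>R mop A" and "v = (1/2) *\<^sub>R mop V"
  have S: "S ** S = J" "S ** N = mat 1" "N ** S = mat 1"
    unfolding S_def N_def using pos_def_sqrt_works(2) inv_sqrt_inverse assms(2) by blast+
  have "invertible C"
    using \<open>det C \<noteq> 0\<close> by (simp add: invertible_det_nz)
  then have C': "C ** C' = mat 1" "C' ** C = mat 1"
    unfolding C'_def by (rule matrix_inv_inverse)+
  then have mC: "mop C * mop C' = 1" "mop C' * mop C = 1"
    by (simp_all add: mop_one flip: mop_mult)
  note W' = W[folded C'_def] and comm = assms(12)[folded C'_def] and sym = assms(13)[folded C'_def]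
  have inter: "conj_exp v (mop C') a t * (mop B - a * a) = (mop W - v * v) * conj_exp v (mop C') a t" for t
    unfolding a_def v_def by (rule conj_exp_intertwines[OF C' comm W'])
  \<comment> \<open>Multiplying the real-part condition by \<open>C'\<close> on both sides gives the
    relation needed to bound the forward transfer; the condition itself bounds the backward
    one.\<close>
  have "C' ** real_part A = C' ** (real_part A ** C) ** C'"
    by (simp only: matrix_mul_assoc[symmetric] C' matrix_mul_rid)
  also have "\<dots> = real_part V ** C'"
    unfolding assms(11)[symmetric] by (simp only: matrix_mul_assoc C' matrix_mul_lid)
  finally have C'R: "C' ** real_part A = real_part V ** C'" .
  let ?\<Theta> = "\<lambda>t z. conj_transfer v (mop C') a t (S *v fst z, S *v snd z)"
  have damped: "damped_solution V W (\<lambda>t. ?\<Theta> t (z t))" if "second_order_solution J (D + G) (P + Q) z" for z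
    using second_order_solution_transfer[OF S A[folded N_def] B[folded N_def], of V "mop C'" W z] inter that
    unfolding a_def v_def by blast
  obtain r where r: "\<And>t x. norm (conj_exp v (mop C') a t \<bullet>\<bullet> x) \<le> r * norm x"
    using conj_exp_mop_bounded[OF C'R] unfolding a_def v_def by blast
  obtain r' where r': "\<And>t x. norm (conj_exp a (mop C) v t \<bullet>\<bullet> x) \<le> r' * norm x"
    using conj_exp_mop_bounded[OF assms(11)] unfolding a_def v_def by blast
  obtain R where R: "R > 0" "\<And>t z. norm (conj_transfer v (mop C') a t z) \<le> R * norm z"
    using conj_transfer_bounded[OF r] by blast
  obtain R' where R': "R' > 0" "\<And>t z. norm (conj_transfer a (mop C) v t z) \<le> R' * norm z"
    using conj_transfer_bounded[OF r'] by blast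
  obtain s where s: "s > 0" "\<And>x y. norm (S *v x, S *v y) \<le> s * norm (x, y)"
    using matrix_pair_bound[of S] by blast
  obtain n where n: "n > 0" "\<And>x y. norm (N *v x, N *v y) \<le> n * norm (x, y)"
    using matrix_pair_bound[of N] by blast
  \<comment> \<open>The constants in \<open>upper\<close> and \<open>lower\<close> do not depend on
    t, so a solution and its image in the damped system have equivalent norms uniformly in
    time.\<close>
  have upper: "norm (?\<Theta> t z) \<le> R * s * norm z" for t z
  proof -
    have "norm (?\<Theta> t z) \<le> R * norm (S *v fst z, S *v snd z)"
      by (rule R)
    also have "\<dots> \<le> R * (s * norm z)"
      using s(2)[of "fst z" "snd z"] R(1) by (intro mult_left_mono) simp_all
    finally show ?thesis
      by (simp add: mult.assoc)
  qed
  have lower: "norm z \<le> n * R' * norm (?\<Theta> t z)" for t z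
  proof -
    have "norm z = norm (N *v (S *v fst z), N *v (S *v snd z))"
      by (simp add: matrix_vector_mul_assoc S)
    also have "\<dots> \<le> n * norm (S *v fst z, S *v snd z)"
      by (rule n)
    also have "\<dots> = n * norm (conj_transfer a (mop C) v t (?\<Theta> t z))"
      by (simp only: conj_transfer_inverse[OF mC(1)])
    also have "\<dots> \<le> n * (R' * norm (?\<Theta> t z))"
      using n(1) by (intro mult_left_mono R') simp
    finally show ?thesis
      by (simp add: mult.assoc)
  qed
  show ?thesis
  proof (intro conjI impI)
    assume "pos_def W"
    then obtain K k where K: "K > 0" "k > 0"
        "\<And>z t. damped_solution V W z \<Longrightarrow> t \<ge> 0 \<Longrightarrow> norm (z t) \<le> K * exp (- k * t) * norm (z 0)"
      using damped_solution_decay[OF assms(10)] by blast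
    show "null_asymptotically_stable J (D + G) (P + Q)"
    proof (rule null_asymptotically_stableI)
      show "n * R' * K * (R * s) > 0" "k > 0"
        using n(1) R'(1) K(1,2) R(1) s(1) by simp_all
      fix z and t :: real
      assume z: "second_order_solution J (D + G) (P + Q) z" and t: "t \<ge> 0"
      have "norm (z t) \<le> n * R' * norm (?\<Theta> t (z t))"
        by (rule lower)
      also have "\<dots> \<le> n * R' * (K * exp (- k * t) * norm (?\<Theta> 0 (z 0)))"
        using n(1) R'(1) by (intro mult_left_mono K(3)[OF damped[OF z] t]) simp
      also have "\<dots> \<le> n * R' * (K * exp (- k * t) * (R * s * norm (z 0)))"
        using n(1) R'(1) K(1) by (intro mult_left_mono upper) simp_all
      finally show "norm (z t) \<le> n * R' * K * (R * s) * exp (- k * t) * norm (z 0)"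
        by (simp only: mult_ac)
    qed
  next
    assume "invertible W \<and> (\<exists>l<0. \<exists>w. w \<noteq> 0 \<and> W *v w = l *\<^sub>R w)"
    then obtain l w where Winv: "invertible W" and w: "l < 0" "w \<noteq> 0" "W *v w = l *\<^sub>R w"
      by blast
    have Wt: "transpose W = W"
    proof -
      \<comment> \<open>The last matrix condition says that this expression for 4 W minus its
        transpose vanishes.\<close>
      have eq: "4 *\<^sub>R W = V ** V + C' ** (4 *\<^sub>R B - A ** A) ** C"
        by (rule mop_inj) (simp add: W' mop_add mop_diff mop_scaleR mop_mult algebra_simps)
      have T: "4 *\<^sub>R transpose W = transpose (V ** V) + transpose C ** transpose (4 *\<^sub>R B - A ** A) ** transpose C'"
        unfolding transpose_scalar[symmetric] eq
        by (simp only: transpose_add matrix_transpose_mul matrix_mul_assoc)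
      have swap: "b + d = a + c" if "a - b + c - d = 0" for a b c d :: "real^'m^'m"
      proof -
        have "a + c - (b + d) = a - b + c - d"
          by simp
        with that show ?thesis
          by simp
      qed
      have "4 *\<^sub>R transpose W = 4 *\<^sub>R W"
        unfolding T eq by (rule swap[OF sym])
      then show ?thesis
        by simp
    qed
    show "null_unstable J (D + G) (P + Q)"
      unfolding null_unstable_def
    proof
      assume "null_stable J (D + G) (P + Q)"
      from null_stableE[OF this, of 1]
      obtain \<delta> where \<delta>: "\<delta> > 0" "\<And>z t. second_order_solution J (D + G) (P + Q) z \<Longrightarrow>
          norm (z 0) < \<delta> \<Longrightarrow> t \<ge> 0 \<Longrightarrow> norm (z t) < 1"
        by auto
      \<comment> \<open>The preimage of (w, 0) under the transfer at time 0. The scaled solution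
        then starts in the damped system at (h w, 0), where the quadratic form of W equals h^2 l
        |w|^2 < 0.\<close>
      define y where "y = conj_transfer a (mop C) v 0 (w, 0)"
      \<comment> \<open>Scales the initial state to norm below half of \<delta>; the added 1 keeps
        the denominator positive.\<close>
      define h where "h = \<delta> / (2 * (norm (N *v fst y, N *v snd y) + 1))"
      have h: "h > 0"
        using \<delta>(1) by (simp add: h_def add_nonneg_pos)
      obtain z where z: "second_order_solution J (D + G) (P + Q) z"
          and z0: "z 0 = h *\<^sub>R (N *v fst y, N *v snd y)"
        using second_order_solution_exists[OF pos_def_invertible[OF assms(2)],
            of "D + G" "P + Q" "h *\<^sub>R (N *v fst y, N *v snd y)"] by blast
      have "norm (z 0) < \<delta>"
      proof -
        let ?g = "norm (N *v fst y, N *v snd y)"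
        have half: "\<delta> / (2 * c) * c = \<delta> / 2" if "c > 0" for c
          using that by simp
        have "norm (z 0) = h * ?g"
          using h by (simp only: z0 norm_scaleR abs_of_pos)
        also have "\<dots> < h * (?g + 1)"
          using h by (intro mult_strict_left_mono) simp_all
        also have "\<dots> = \<delta> / 2"
          unfolding h_def by (rule half) (simp add: add_nonneg_pos)
        finally show ?thesis
          using \<delta>(1) by linarith
      qed
      then have less1: "norm (z t) < 1" if "t \<ge> 0" for t
        using \<delta>(2)[OF z] that by blast
      have bound: "norm (?\<Theta> t (z t)) \<le> R * s" if "t \<ge> 0" for t
      proof -
        have "norm (?\<Theta> t (z t)) \<le> R * s * norm (z t)"
          by (rule upper)
        also have "\<dots> \<le> R * s * 1"
          using less1[OF that] R(1) s(1) by (intro mult_left_mono) simp_all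
        finally show ?thesis
          by simp
      qed
      have "(S *v fst (z 0), S *v snd (z 0)) = h *\<^sub>R y"
        unfolding z0 by (simp add: linear_scale matrix_vector_mul_assoc S prod_eq_iff)
      then have "?\<Theta> 0 (z 0) = h *\<^sub>R conj_transfer v (mop C') a 0 y"
        by (simp add: conj_transfer_def app.scaleR_right scaleR_add_right)
      then have \<Theta>0: "?\<Theta> 0 (z 0) = (h *\<^sub>R w, 0)"
        unfolding y_def conj_transfer_inverse[OF mC(2)] by simp
      show False
      proof (rule damped_solution_unbounded[OF assms(10) Wt Winv damped[OF z] _ _ bound])
        show "snd (?\<Theta> 0 (z 0)) = 0"
          unfolding \<Theta>0 by simp
        show "fst (?\<Theta> 0 (z 0)) \<bullet> (W *v fst (?\<Theta> 0 (z 0))) < 0"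
        proof -
          have "fst (?\<Theta> 0 (z 0)) \<bullet> (W *v fst (?\<Theta> 0 (z 0))) = l * (h * h * (w \<bullet> w))"
            unfolding \<Theta>0 by (simp add: linear_scale w(3))
          also have "\<dots> < 0"
            using h w(1,2) by (intro mult_neg_pos) simp_all
          finally show ?thesis .
        qed
      qed
    qed
  qed
qed

end
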